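(* Every expanded lattice angle is proper lattice-congruent to exactly one of the following expanded lattice angles: the angle $0\pi+\operatorname{larctan}(0)=\angle(O,(1,0))$ (type I); the angles $\Phi_S$ with $S$ of type II$_k$ ($k\ge1$), III$_k$ ($k\ge1$), IV$_k$ ($k\ge0$, $n\ge0$, $a_0,\dots,a_{2n}$ positive integers) or V$_k$ ($k\ge1$, $n\ge0$, $a_0,\dots,a_{2n}$ positive integers). In particular the type is uniquely determined, and within each type the listed angle is unique.
   Context: We work in $\mathbb R^2$ with standard orientation, lattice $\mathbb Z^2$, origin $O$. A lattice-affine transformation $x\mapsto Mx+b$ ($M\in GL_2(\mathbb Z)$, $b\in\mathbb Z^2$) is proper if $\det M=1$. $\operatorname{l\ell}(AB)$ is the number of lattice points on segment $AB$ minus one; $\operatorname{sgn}(A,B,C)$ is the sign of $\det(A-B,C-B)$. For an ordinary lattice angle $\angle XYZ$ (lattice points not collinear, rays $YX$, $YZ$) let $v_1,v_2$ be primitive lattice vectors along $YX$, $YZ$; lattice points $P$ with $(v_1,P-Y)$ a basis form two lines parallel to $YX$, ray $YZ$ meets exactly one, $l$, at $Q$; let $D$ be the lattice point of $l$ nearest $Q$ among those strictly on the other side of line $YZ$ from $X$; writing $v_2=x_1v_1+x_2(D-Y)$, $\operatorname{lsin}\angle XYZ=x_2$. A lattice oriented broken line $A_0A_1\dots A_n$ ($n\ge1$) is a sequence of lattice points with $A_{i-1}\ne A_i$ and no two consecutive segments in one line; it is on unit distance from lattice point $V$ if for each $i$ the primitive vector along $A_{i-1}A_i$ and $V-A_{i-1}$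 form a basis of $\mathbb Z^2$. Its signed length-sine sequence is $(a_0,\dots,a_{2n-2})$ with $a_{2i-2}=\operatorname{sgn}(A_{i-1},V,A_i)\operatorname{l\ell}(A_{i-1}A_i)$ and $a_{2i-1}=\operatorname{sgn}(A_{i-1},V,A_i)\operatorname{sgn}(A_i,V,A_{i+1})\operatorname{sgn}(A_{i-1},A_i,A_{i+1})\operatorname{lsin}\angle A_{i-1}A_iA_{i+1}$. Two such broken lines on unit distance from $V$ are equivalent if they have the same first and last vertices and the closed path formed by the first followed by the reverse of the second is null-homotopic in $\mathbb R^2\setminus\{V\}$. The equivalence class of $A_0\dots A_n$ is the expanded lattice angle $\angle(V,A_0A_1\dots A_n)$; we also allow the one-point broken line, giving $\angle(V,A_0)$. Two expanded lattice angles are proper lattice-congruent if a proper lattice-affine transformation sends the vertex and class of one to the vertex and class of the other. Normal forms: $(x_1,\dots,x_r)\times j$ denotes $j$ consecutive copies of $(x_1,\dots,x_r)$. For a finite sequence $S$ of nonzero integers, $\Phi_S=\angle(O,A_0A_1\dots A_s)$ where $A_0\dots A_s$ is the lattice oriented broken line on unit distance from $O$ with $A_0=(1,0)$, $A_1$ on the line $x=1$, and signed length-sine sequence $S$ (for the sequences below it exists and is unique). Types: II$_k$: $S=((1,-2,1,-2)\times(k-1),1,-2,1)$, denoted $k\pi+\operatorname{larctan}(0)$; III$_k$: $S=((-1,2,-1,2)\times(k-1),-1,2,-1)$, denoted $-k\pi+\operatorname{larctan}(0)$; IV$_k$: $S=((1,-2,1,-2)\times k,a_0,\dots,a_{2n})$,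 denoted $k\pi+\operatorname{larctan}([a_0;a_1,\dots,a_{2n}])$; V$_k$: $S=((-1,2,-1,2)\times k,a_0,\dots,a_{2n})$, denoted $-k\pi+\operatorname{larctan}([a_0;a_1,\dots,a_{2n}])$.
   Formalization: For the one-point broken line giving ∠(V,A_0), the vector V−A_0 is required to be primitive; without this the claim fails, e.g. ∠(O,(2,0)) is not proper lattice-congruent to any listed angle. One-point lines take part in the equivalence of broken lines. *)

theory Defs
  imports "HOL-Analysis.Analysis"
begin

text \<open>Points of the lattice $Z^2$ have type \<open>int^2\<close>; \<open>emb\<close> is the inclusion into the plane.\<close>

type_synonym lpoint = "int^2"

definition emb :: "lpoint \<Rightarrow> real^2" where
  "emb P = (\<chi> i. of_int (P $ i))"

definition lattice_basis :: "lpoint \<Rightarrow> lpoint \<Rightarrow> bool" where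
  "lattice_basis u v \<longleftrightarrow> (\<forall>w. \<exists>!(m, n). w = m *s u + n *s v)"

definition primitive :: "lpoint \<Rightarrow> bool" where
  "primitive v \<longleftrightarrow> coprime (v $ 1) (v $ 2)"

definition prim_vec :: "lpoint \<Rightarrow> lpoint \<Rightarrow> lpoint" where
  "prim_vec A B = (THE v. primitive v \<and> (\<exists>m>0. B - A = m *s v))"

definition lattice_length :: "lpoint \<Rightarrow> lpoint \<Rightarrow> nat" where
  "lattice_length A B = card {P. emb P \<in> closed_segment (emb A) (emb B)} - 1"

definition osign :: "lpoint \<Rightarrow> lpoint \<Rightarrow> lpoint \<Rightarrow> int" where
  "osign A B C = sgn (det (vector [A - B, C - B] :: int^2^2))"


subsection \<open>Lattice sine\<close>

definition ray :: "lpoint \<Rightarrow> lpoint \<Rightarrow> (real^2) set" where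
  "ray Y Z = {emb Y + t *\<^sub>R (emb Z - emb Y) | t. t \<ge> 0}"

text \<open>The lines parallel to \<open>YX\<close> carrying the lattice points \<open>P\<close> for which the primitive vector
  along \<open>YX\<close> and \<open>P - Y\<close> form a basis.\<close>

definition unit_lines :: "lpoint \<Rightarrow> lpoint \<Rightarrow> (real^2) set set" where
  "unit_lines Y X =
     {{emb P + t *\<^sub>R emb (prim_vec Y X) | t. True} | P. lattice_basis (prim_vec Y X) (P - Y)}"

definition lsin :: "lpoint \<Rightarrow> lpoint \<Rightarrow> lpoint \<Rightarrow> int" where
  "lsin X Y Z = (THE x2. \<exists>x1 l Q D.
      l \<in> unit_lines Y X \<and> Q \<in> l \<and> Q \<in> ray Y Z \<and>
      is_arg_min (\<lambda>P. dist (emb P) Q) (\<lambda>P. emb P \<in> l \<and> osign X Y Z * osign P Y Z < 0) D \<and>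
      prim_vec Y Z = x1 *s prim_vec Y X + x2 *s (D - Y))"


subsection \<open>Lattice oriented broken lines\<close>

definition broken_line :: "lpoint list \<Rightarrow> bool" where
  "broken_line As \<longleftrightarrow> length As \<ge> 2 \<and>
     (\<forall>i. i + 1 < length As \<longrightarrow> As ! i \<noteq> As ! (i + 1)) \<and>
     (\<forall>i. i + 2 < length As \<longrightarrow>
        \<not> collinear {emb (As ! i), emb (As ! (i + 1)), emb (As ! (i + 2))})"

definition unit_distance :: "lpoint \<Rightarrow> lpoint list \<Rightarrow> bool" where
  "unit_distance V As \<longleftrightarrow>
     (\<forall>i. i + 1 < length As \<longrightarrow> lattice_basis (prim_vec (As ! i) (As ! (i + 1))) (V - As ! i))"

definition signed_length_sine :: "lpoint \<Rightarrow> lpoint list \<Rightarrow> int list" where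
  "signed_length_sine V As =
     map (\<lambda>j. let i = j div 2 in
           if even j then osign (As ! i) V (As ! (i + 1)) * int (lattice_length (As ! i) (As ! (i + 1)))
           else osign (As ! i) V (As ! (i + 1)) * osign (As ! (i + 1)) V (As ! (i + 2)) *
                osign (As ! i) (As ! (i + 1)) (As ! (i + 2)) *
                lsin (As ! i) (As ! (i + 1)) (As ! (i + 2)))
       [0..<2 * (length As - 1) - 1]"

text \<open>A one-point broken line has no segment to impose unit distance from the vertex; as for the
  vertices of all longer lines on unit distance, the vector from its point to \<open>V\<close> is required
  to be primitive.\<close>

definition unit_broken_line :: "lpoint \<Rightarrow> lpoint list \<Rightarrow> bool" where
  "unit_broken_line V As \<longleftrightarrow>
     broken_line As \<and> unit_distance V As \<or> (\<exists>A. As = [A] \<and> primitive (V - A))"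

fun broken_path :: "lpoint list \<Rightarrow> real \<Rightarrow> real^2" where
  "broken_path [A] = linepath (emb A) (emb A)"
| "broken_path [A, B] = linepath (emb A) (emb B)"
| "broken_path (A # B # C # As) = linepath (emb A) (emb B) +++ broken_path (B # C # As)"


subsection \<open>Expanded lattice angles\<close>

definition line_equiv :: "lpoint \<Rightarrow> lpoint list \<Rightarrow> lpoint list \<Rightarrow> bool" where
  "line_equiv V As Bs \<longleftrightarrow> unit_broken_line V As \<and> unit_broken_line V Bs \<and>
     hd As = hd Bs \<and> last As = last Bs \<and>
     (\<exists>c. homotopic_loops (UNIV - {emb V})
            (broken_path As +++ reversepath (broken_path Bs)) (linepath c c))"

text \<open>An expanded lattice angle is the pair of its vertex and an equivalence class.\<close>

type_synonym exp_angle = "lpoint \<times> lpoint list set"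

definition angle :: "lpoint \<Rightarrow> lpoint list \<Rightarrow> exp_angle" where
  "angle V As = (V, {Bs. line_equiv V As Bs})"

definition expanded_lattice_angle :: "exp_angle \<Rightarrow> bool" where
  "expanded_lattice_angle \<alpha> \<longleftrightarrow> (\<exists>V As. unit_broken_line V As \<and> \<alpha> = angle V As)"

definition proper_lattice_affine :: "(lpoint \<Rightarrow> lpoint) \<Rightarrow> bool" where
  "proper_lattice_affine f \<longleftrightarrow>
     (\<exists>(M :: int^2^2) b. invertible M \<and> det M = 1 \<and> f = (\<lambda>x. M *v x + b))"

definition proper_congruent :: "exp_angle \<Rightarrow> exp_angle \<Rightarrow> bool" where
  "proper_congruent \<alpha> \<beta> \<longleftrightarrow>
     (\<exists>f. proper_lattice_affine f \<and> f (fst \<alpha>) = fst \<beta> \<and> map f ` snd \<alpha> = snd \<beta>)"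


subsection \<open>Normal forms\<close>

definition Phi :: "int list \<Rightarrow> exp_angle" where
  "Phi S = angle 0 (THE As. broken_line As \<and> unit_distance 0 As \<and>
     As ! 0 = vector [1, 0] \<and> (As ! 1) $ 1 = 1 \<and> signed_length_sine 0 As = S)"

definition copies :: "int list \<Rightarrow> nat \<Rightarrow> int list" where
  "copies xs j = concat (replicate j xs)"

datatype normal_form =
    Type_I
  | Type_II nat
  | Type_III nat
  | Type_IV nat "int list"
  | Type_V nat "int list"

definition cf_elements :: "int list \<Rightarrow> bool" where
  "cf_elements as \<longleftrightarrow> (\<exists>n. length as = 2 * n + 1) \<and> (\<forall>a \<in> set as. a > 0)"

fun valid_form :: "normal_form \<Rightarrow> bool" where
  "valid_form Type_I \<longleftrightarrow> True"
| "valid_form (Type_II k) \<longleftrightarrow> k \<ge> 1"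
| "valid_form (Type_III k) \<longleftrightarrow> k \<ge> 1"
| "valid_form (Type_IV k as) \<longleftrightarrow> cf_elements as"
| "valid_form (Type_V k as) \<longleftrightarrow> k \<ge> 1 \<and> cf_elements as"

fun form_angle :: "normal_form \<Rightarrow> exp_angle" where
  "form_angle Type_I = angle 0 [vector [1, 0]]"
| "form_angle (Type_II k) = Phi (copies [1, -2, 1, -2] (k - 1) @ [1, -2, 1])"
| "form_angle (Type_III k) = Phi (copies [-1, 2, -1, 2] (k - 1) @ [-1, 2, -1])"
| "form_angle (Type_IV k as) = Phi (copies [1, -2, 1, -2] k @ as)"
| "form_angle (Type_V k as) = Phi (copies [-1, 2, -1, 2] k @ as)"

end

theory Submission imports Defs "HOL-Complex_Analysis.Riemann_Mapping" begin

text \<open>Put the vertex at the origin. A line on unit distance is then generated by its first vertex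
  \<open>A\<close>, a vector \<open>w\<close> with \<open>det (A, w) = 1\<close>, and its signed length-sine sequence, by the continued
  fraction recursion; so \<open>Phi S\<close> is explicit. The total angle turned around the origin is
  \<open>2 * pi\<close> times the real part of the winding number, hence two lines are equivalent iff they have
  the same end points and the same total turn. The blocks \<open>(1, -2, 1, -2)\<close> and \<open>(-1, 2, -1, 2)\<close>
  are half turns, and a positive continued fraction turns by an angle in the open interval from
  \<open>0\<close> to \<open>pi\<close>. A proper transformation moves the first vertex to \<open>(1, 0)\<close>; the remaining freedom is a
  horizontal shear, which brings the last vertex to \<open>\<plusminus>(1, 0)\<close> or to \<open>\<plusminus>(q, p)\<close> with
  \<open>1 \<le> q \<le> p\<close> in exactly one way. Shears do not change the number of completed half turns, which
  gives uniqueness.\<close>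

subsection \<open>Lattice arithmetic\<close>

text \<open>The obstacle is that the signed length-sine sequence is no invariant of the class:
  homotopic lines may have quite different sequences. The total turn is one, but shears change its
  value, so congruence is transported by homotopies in the real plane, and turns are compared only
  for lines around the origin that start at \<open>(1, 0)\<close>. There the sign of the last vertex
  is the parity of the number \<open>k\<close> of half turns, because the rest of the turn is an
  argument in the half-open interval from \<open>0\<close> to \<open>pi\<close>. The five types
  thereby collapse to pairs of an integer \<open>k\<close> and a positive list of odd length or the
  empty list. The range \<open>1 \<le> q \<le> p\<close>, instead of residues from \<open>0\<close>
  to \<open>p - 1\<close>, comes from the first element: if it is positive, \<open>p / q\<close> is
  at least 1. Odd length makes the expansion of \<open>p / q\<close> unique, since of the two
  endings \<open>a\<close> and \<open>a - 1, 1\<close> it admits only one.\<close>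

definition cross :: "lpoint \<Rightarrow> lpoint \<Rightarrow> int" where
  "cross u v = u$1 * v$2 - u$2 * v$1"

lemma lpoint_eq_iff: "(P::lpoint) = Q \<longleftrightarrow> P$1 = Q$1 \<and> P$2 = Q$2"
  by (simp add: vec_eq_iff forall_2)

lemma cross_simps:
  "cross (u + v) w = cross u w + cross v w" "cross w (u + v) = cross w u + cross w v"
  "cross (u - v) w = cross u w - cross v w" "cross w (u - v) = cross w u - cross w v"
  "cross (m *s u) v = m * cross u v" "cross u (m *s v) = m * cross u v"
  "cross (- u) v = - cross u v" "cross u (- v) = - cross u v"
  "cross u u = 0" "cross 0 u = 0" "cross u 0 = 0"
  by (simp_all add: cross_def algebra_simps)

lemma cross_swap: "cross v u = - cross u v"
  by (simp add: cross_def)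

lemma det_vector_eq_cross: "det (vector [u, v] :: int^2^2) = cross u v"
  by (simp add: det_2 cross_def)

lemma osign_eq_cross: "osign A B C = sgn (cross (A - B) (C - B))"
  by (simp add: osign_def det_vector_eq_cross)

lemma cramer:
  "cross u v *s w = cross w v *s u + cross u w *s v"
  by (simp add: lpoint_eq_iff cross_def algebra_simps)

text \<open>If the two unit vectors are integer combinations, \<open>cross u v\<close> divides their
  determinant 1. Conversely \<open>cross u v\<close> is its own inverse, so Cramer's rule has
  integer solutions.\<close>

lemma lattice_basis_iff_cross: "lattice_basis u v \<longleftrightarrow> \<bar>cross u v\<bar> = 1"
proof
  assume L: "lattice_basis u v"
  have ex: "\<exists>m n. w = m *s u + n *s v" for w
    using L[unfolded lattice_basis_def, rule_format, of w] by auto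
  obtain m n where 1: "vector [1, 0] = m *s u + n *s v" using ex by blast
  obtain m' n' where 2: "vector [0, 1] = m' *s u + n' *s v" using ex by blast
  have "cross (vector [1, 0]) (vector [0, 1]) = (m * n' - n * m') * cross u v"
    unfolding 1 2 by (simp add: cross_def algebra_simps)
  also have "cross (vector [1, 0]) (vector [0, 1]) = 1" by (simp add: cross_def)
  finally have "cross u v dvd 1" by (metis dvd_triv_right)
  then show "\<bar>cross u v\<bar> = 1" by simp
next
  assume c: "\<bar>cross u v\<bar> = 1"
  then have c2: "cross u v * cross u v = 1" by (metis abs_mult_self_eq mult_1)
  show "lattice_basis u v"
    unfolding lattice_basis_def
  proof (intro allI ex1I[of _ "(cross u v * cross w v, cross u v * cross u w)" for w])
    fix w
    have "(cross u v * cross w v) *s u + (cross u v * cross u w) *s v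
        = cross u v *s (cross u v *s w)"
      unfolding cramer[of u v w] by (simp add: vector_add_ldistrib vector_smult_assoc)
    also have "\<dots> = w" by (simp add: vector_smult_assoc c2)
    finally show "case (cross u v * cross w v, cross u v * cross u w) of
        (m, n) \<Rightarrow> w = m *s u + n *s v" by simp
  next
    fix w and y :: "int \<times> int"
    assume y: "case y of (m, n) \<Rightarrow> w = m *s u + n *s v"
    obtain m n where "y = (m, n)" by force
    then have "cross w v = m * cross u v" "cross u w = n * cross u v"
      using y by (simp_all add: cross_simps)
    then show "y = (cross u v * cross w v, cross u v * cross u w)"
      using c2 \<open>y = (m, n)\<close> by (simp add: mult.left_commute)
  qed
qed

text \<open>Bezout's identity. In this form primitivity is visibly preserved by linear maps of
  determinant one.\<close>

lemma primitive_iff_cross: "primitive u \<longleftrightarrow> (\<exists>w. cross u w = 1)"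
proof
  assume "primitive u"
  then obtain a b where "a * u$1 + b * u$2 = 1"
    unfolding primitive_def by (metis coprime_iff_gcd_eq_1 bezout_int)
  then have "cross u (vector [-b, a]) = 1" by (simp add: cross_def algebra_simps)
  then show "\<exists>w. cross u w = 1" by blast
next
  assume "\<exists>w. cross u w = 1"
  then obtain w where w: "cross u w = 1" by blast
  show "primitive u" unfolding primitive_def
  proof (rule coprimeI)
    fix c assume "c dvd u$1" "c dvd u$2"
    then have "c dvd cross u w" unfolding cross_def by (simp add: dvd_diff)
    then show "is_unit c" using w by simp
  qed
qed

lemma primitive_if_abs_cross: "\<bar>cross u w\<bar> = 1 \<Longrightarrow> primitive u"
  by (metis primitive_iff_cross abs_eq_iff' cross_simps(8) minus_minus)

lemma primitive_scale_unique:
  assumes "primitive u" "primitive v" "m > 0" "n > 0" "m *s u = n *s v"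
  shows "u = v" "m = n"
proof -
  obtain a where a: "cross u a = 1" using assms(1) primitive_iff_cross by blast
  obtain b where b: "cross v b = 1" using assms(2) primitive_iff_cross by blast
  have "cross (m *s u) a = cross (n *s v) a" "cross (m *s u) b = cross (n *s v) b"
    using assms(5) by simp_all
  then have "n dvd m" "m dvd n" using a b by (metis cross_simps(5) dvd_triv_left mult.right_neutral)+
  then show "m = n" using assms(3,4) zdvd_antisym_nonneg by auto
  then show "u = v" using assms by (simp add: lpoint_eq_iff)
qed

lemma prim_vec_eqI:
  assumes "primitive u" "m > 0" "B - A = m *s u"
  shows "prim_vec A B = u"
  unfolding prim_vec_def
proof (rule the_equality)
  show "primitive u \<and> (\<exists>m>0. B - A = m *s u)" using assms by blast
next
  fix v assume "primitive v \<and> (\<exists>m>0. B - A = m *s v)"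
  then show "v = u" using assms by (metis primitive_scale_unique(1))
qed

lemma prim_vec_props:
  assumes "A \<noteq> B"
  obtains m where "m > 0" "primitive (prim_vec A B)" "B - A = m *s prim_vec A B"
proof -
  define d where "d = B - A"
  define g where "g = gcd (d$1) (d$2)"
  have "d \<noteq> 0" using assms by (simp add: d_def)
  then have g: "g > 0" by (auto simp: g_def lpoint_eq_iff)
  define u :: lpoint where "u = vector [d$1 div g, d$2 div g]"
  have "primitive u" using g unfolding primitive_def u_def g_def vector_2
    by (intro div_gcd_coprime) auto
  moreover have "B - A = g *s u"
    by (simp add: lpoint_eq_iff u_def d_def[symmetric]) (simp add: g_def)
  ultimately show thesis using that[of g] g prim_vec_eqI by metis
qed

lemma parallel_to_primitive:
  assumes "cross u a = 1" "cross u v = 0"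
  shows "v = cross v a *s u"
  using cramer[of u a v] assms by simp

section \<open>The real plane, lattice length and lattice sine\<close>

lemma emb_simps:
  "emb (P + Q) = emb P + emb Q" "emb (P - Q) = emb P - emb Q" "emb (m *s P) = of_int m *\<^sub>R emb P"
  by (simp_all add: emb_def vec_eq_iff)

lemma emb_0 [simp]: "emb 0 = 0"
  by (simp add: emb_def vec_eq_iff)

definition rcross :: "real^2 \<Rightarrow> real^2 \<Rightarrow> real" where
  "rcross u v = u$1 * v$2 - u$2 * v$1"

lemma rcross_simps:
  "rcross (u + v) w = rcross u w + rcross v w" "rcross w (u + v) = rcross w u + rcross w v"
  "rcross (u - v) w = rcross u w - rcross v w" "rcross w (u - v) = rcross w u - rcross w v"
  "rcross (m *\<^sub>R u) v = m * rcross u v" "rcross u (m *\<^sub>R v) = m * rcross u v"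
  "rcross u u = 0" "rcross 0 u = 0" "rcross u 0 = 0"
  by (simp_all add: rcross_def algebra_simps)

lemma rcross_emb: "rcross (emb u) (emb v) = of_int (cross u v)"
  by (simp add: rcross_def cross_def emb_def)

lemma rcramer: "rcross u v *\<^sub>R w = rcross w v *\<^sub>R u + rcross u w *\<^sub>R v"
  by (simp add: vec_eq_iff forall_2 rcross_def algebra_simps)

lemma collinear_emb_iff:
  "collinear {emb A, emb B, emb C} \<longleftrightarrow> cross (A - B) (C - B) = 0"
proof -
  have "collinear {emb A, emb B, emb C} \<longleftrightarrow> collinear {0, emb A - emb B, emb C - emb B}"
    by (auto simp: collinear_def)
  also have "\<dots> \<longleftrightarrow> collinear {0, emb (A - B), emb (C - B)}" by (simp add: emb_simps)
  also have "\<dots> \<longleftrightarrow> cross (A - B) (C - B) = 0" (is "?l \<longleftrightarrow> ?r")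
  proof
    assume ?l
    then have "rcross (emb (A - B)) (emb (C - B)) = 0"
      unfolding collinear_lemma by (auto simp: rcross_simps)
    then show ?r by (simp add: rcross_emb)
  next
    assume r: ?r
    show ?l
    proof (cases "A = B")
      case True then show ?thesis by simp
    next
      case False
      obtain m where m: "m > 0" "primitive (prim_vec B A)" "A - B = m *s prim_vec B A"
        using False prim_vec_props by metis
      obtain a where a: "cross (prim_vec B A) a = 1" using m(2) primitive_iff_cross by blast
      have "cross (prim_vec B A) (C - B) = 0" using r m by (simp add: cross_simps)
      from parallel_to_primitive[OF a this] obtain n where n: "C - B = n *s prim_vec B A" by blast
      have "emb (C - B) = (of_int n / of_int m) *\<^sub>R emb (A - B)"
        unfolding n m(3) emb_simps using m(1) by simp
      then show ?thesis unfolding collinear_lemma by blast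
    qed
  qed
  finally show ?thesis .
qed

text \<open>The lattice points of the segment are \<open>A + j *s u\<close> with \<open>j\<close>
  from \<open>0\<close> to \<open>m\<close>; a complement \<open>a\<close> of the primitive vector
  \<open>u\<close> reads off the integer \<open>j\<close> from the real parameter.\<close>

lemma lattice_length_eq:
  assumes "primitive u" "m > 0" "B - A = m *s u"
  shows "lattice_length A B = nat m"
proof -
  obtain a where a: "cross u a = 1" using assms(1) primitive_iff_cross by blast
  have u0: "u \<noteq> 0" using a by (auto simp: cross_simps)
  have B: "B = A + m *s u" using assms(3) by (simp add: algebra_simps)
  have "{P. emb P \<in> closed_segment (emb A) (emb B)} = (\<lambda>j. A + j *s u) ` {0..m}"
  proof (intro equalityI subsetI)
    fix P assume "P \<in> {P. emb P \<in> closed_segment (emb A) (emb B)}"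
    then obtain s where s: "0 \<le> s" "s \<le> 1" "emb P = (1 - s) *\<^sub>R emb A + s *\<^sub>R emb B"
      by (auto simp: closed_segment_def)
    then have e: "emb (P - A) = (s * of_int m) *\<^sub>R emb u"
      by (simp add: B emb_simps algebra_simps)
    have "rcross (emb u) (emb (P - A)) = 0" by (simp add: e rcross_simps)
    then have "cross u (P - A) = 0" by (simp add: rcross_emb)
    from parallel_to_primitive[OF a this] obtain j where j: "P - A = j *s u" by blast
    have "rcross (emb (P - A)) (emb a) = s * of_int m"
      unfolding e rcross_simps by (simp add: rcross_emb a)
    then have js: "of_int j = s * of_int m" by (simp add: rcross_emb j cross_simps a)
    have "0 \<le> j" "j \<le> m"
    proof -
      have "0 \<le> (of_int j :: real)" "(of_int j::real) \<le> of_int m"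
        unfolding js using s assms(2) by (auto intro: mult_left_le_one_le)
      then show "0 \<le> j" "j \<le> m" by simp_all
    qed
    then show "P \<in> (\<lambda>j. A + j *s u) ` {0..m}" using j by (intro image_eqI[of _ _ j]) (auto simp: algebra_simps)
  next
    fix P assume "P \<in> (\<lambda>j. A + j *s u) ` {0..m}"
    then obtain j where j: "0 \<le> j" "j \<le> m" "P = A + j *s u" by auto
    have "emb P = (1 - of_int j / of_int m) *\<^sub>R emb A + (of_int j / of_int m) *\<^sub>R emb B"
      using assms(2) by (simp add: B j(3) emb_simps algebra_simps)
    then show "P \<in> {P. emb P \<in> closed_segment (emb A) (emb B)}"
      using j assms(2) unfolding closed_segment_def by fastforce
  qed
  moreover have "inj_on (\<lambda>j. A + j *s u) {0..m}"
  proof (rule inj_onI)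
    fix i j assume "A + i *s u = A + j *s u"
    then show "i = j" using u0 by (auto simp: lpoint_eq_iff)
  qed
  ultimately have "card {P. emb P \<in> closed_segment (emb A) (emb B)} = nat (m + 1)"
    by (simp add: card_image)
  then show ?thesis unfolding lattice_length_def by simp
qed

text \<open>Every point of the line met by the ray has the same determinant \<open>s\<close> with
  \<open>u\<close>, so \<open>cross u v = x2 * s\<close> whichever point of it is taken for
  \<open>D\<close>; the choice of the nearest one affects only \<open>x1\<close>. Most of the work
  is to show that a suitable \<open>D\<close> exists.\<close>

lemma lsin_eq_abs_cross:
  assumes "cross (X - Y) (Z - Y) \<noteq> 0"
  shows "lsin X Y Z = \<bar>cross (prim_vec Y X) (prim_vec Y Z)\<bar>"
proof -
  define u where "u = prim_vec Y X"
  define v where "v = prim_vec Y Z"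
  define c where "c = cross u v"
  define s where "s = sgn c"
  have "Y \<noteq> X" "Y \<noteq> Z" using assms by (auto simp: cross_simps)
  obtain m where m: "m > 0" "primitive u" "X - Y = m *s u"
    using prim_vec_props[OF \<open>Y \<noteq> X\<close>] u_def by metis
  obtain n where n: "n > 0" "primitive v" "Z - Y = n *s v"
    using prim_vec_props[OF \<open>Y \<noteq> Z\<close>] v_def by metis
  have c0: "c \<noteq> 0" using assms by (simp add: m n cross_simps c_def)
  have sc: "s * c = \<bar>c\<bar>" "s * s = 1" "\<bar>s\<bar> = 1" using c0 by (auto simp: s_def sgn_if)
  obtain a where a: "cross u a = 1" using m(2) primitive_iff_cross by blast
  \<comment> \<open>Of the two unit lines, the one through \<open>Y + b\<close> is on the side of
    \<open>Z\<close>, because \<open>cross u b\<close> has the sign of \<open>c\<close>.\<close>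
  define b where "b = s *s a"
  have b: "cross u b = s" by (simp add: b_def a cross_simps)
  have sX: "osign X Y Z = s"
    using m(1) n(1) by (simp add: osign_eq_cross m n cross_simps s_def c_def sgn_mult)
  have oP: "osign P Y Z = sgn (cross (P - Y) v)" for P
    using n(1) by (simp add: osign_eq_cross n cross_simps sgn_mult)
  define l where "l = {emb (Y + b) + t *\<^sub>R emb u | t. True}"
  \<comment> \<open>The parameter at which \<open>l\<close> crosses the line \<open>YZ\<close>: the
    solution of \<open>cross b v + \<tau> * c = 0\<close>.\<close>
  define \<tau> :: real where "\<tau> = - of_int (s * cross b v) / of_int \<bar>c\<bar>"
  define Q where "Q = emb (Y + b) + \<tau> *\<^sub>R emb u"
  have l_in: "l \<in> unit_lines Y X"
    unfolding unit_lines_def l_def u_def[symmetric]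
    by (auto simp: lattice_basis_iff_cross sc b intro!: exI[of _ "Y + b"])
  have ccb: "of_int c *\<^sub>R emb b = rcross (emb b) (emb v) *\<^sub>R emb u + of_int s *\<^sub>R emb v"
    using rcramer[of "emb u" "emb v" "emb b"] by (simp add: rcross_emb b c_def)
  have Qv: "Q = emb Y + (1 / of_int \<bar>c\<bar>) *\<^sub>R emb v"
  proof -
    define k :: real where "k = of_int \<bar>c\<bar>"
    have k: "k \<noteq> 0" "k = of_int s * of_int c"
      using c0 unfolding k_def by (simp, metis sc(1) of_int_mult)
    have k3: "k * \<tau> = - of_int (s * cross b v)"
      using k(1) unfolding \<tau>_def k_def[symmetric] by simp
    have "k *\<^sub>R (emb b + \<tau> *\<^sub>R emb u) = k *\<^sub>R emb b + (k * \<tau>) *\<^sub>R emb u"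
      by (simp add: scaleR_add_right)
    also have "\<dots> = (of_int s * of_int c) *\<^sub>R emb b - of_int (s * cross b v) *\<^sub>R emb u"
      unfolding k3 unfolding k(2) by simp
    also have "\<dots> = of_int s *\<^sub>R (of_int c *\<^sub>R emb b) - of_int (s * cross b v) *\<^sub>R emb u" by simp
    also have "\<dots> = of_int (s * s) *\<^sub>R emb v"
      unfolding ccb by (simp add: rcross_emb scaleR_add_right)
    also have "\<dots> = emb v" by (simp add: sc)
    finally have "(1 / k) *\<^sub>R (k *\<^sub>R (emb b + \<tau> *\<^sub>R emb u)) = (1 / k) *\<^sub>R emb v" by simp
    then have "emb b + \<tau> *\<^sub>R emb u = (1 / of_int \<bar>c\<bar>) *\<^sub>R emb v"
      using k(1) by (simp add: k_def)
    then show ?thesis by (simp add: Q_def emb_simps add.assoc)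
  qed
  have Q_ray: "Q \<in> ray Y Z"
  proof -
    have "Q = emb Y + (1 / (of_int \<bar>c\<bar> * of_int n)) *\<^sub>R (emb Z - emb Y)"
      unfolding Qv using n(1) by (simp add: n(3) emb_simps flip: emb_simps(2))
    then show ?thesis unfolding ray_def using n(1) by (auto intro!: exI[of _ "1 / (of_int \<bar>c\<bar> * of_int n)"])
  qed
  have on_l: "\<exists>j. P = Y + b + j *s u" if P: "emb P \<in> l" for P
  proof -
    obtain t where "emb P = emb (Y + b) + t *\<^sub>R emb u" using P unfolding l_def by blast
    then have "emb (P - (Y + b)) = t *\<^sub>R emb u" by (simp add: emb_simps)
    then have "rcross (emb u) (emb (P - (Y + b))) = 0" by (simp add: rcross_simps)
    then have "cross u (P - (Y + b)) = 0" by (simp add: rcross_emb)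
    from parallel_to_primitive[OF a this] show ?thesis
      by (metis add.commute diff_add_cancel)
  qed
  have side: "osign X Y Z * osign (Y + b + j *s u) Y Z < 0 \<longleftrightarrow> of_int j < \<tau>" for j
  proof -
    have "osign X Y Z * osign (Y + b + j *s u) Y Z = sgn (s * (cross b v + j * c))"
      unfolding sX unfolding oP by (simp add: cross_simps c_def[symmetric] sgn_mult s_def)
    also have "s * (cross b v + j * c) = s * cross b v + j * \<bar>c\<bar>"
      by (simp add: algebra_simps flip: sc(1))
    also have "sgn (s * cross b v + j * \<bar>c\<bar>) < 0 \<longleftrightarrow> s * cross b v + j * \<bar>c\<bar> < 0"
      by (simp add: sgn_if)
    also have "\<dots> \<longleftrightarrow> of_int j < \<tau>"
    proof -
      have "of_int j < \<tau> \<longleftrightarrow> of_int j * of_int \<bar>c\<bar> < (- of_int (s * cross b v) :: real)"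
        unfolding \<tau>_def using c0 by (subst pos_less_divide_eq) auto
      also have "\<dots> \<longleftrightarrow> (of_int (s * cross b v + j * \<bar>c\<bar>) :: real) < 0" by auto
      finally show ?thesis by linarith
    qed
    finally show ?thesis .
  qed
  \<comment> \<open>The points opposite to \<open>X\<close> have parameter strictly below
    \<open>\<tau>\<close>, and this is the greatest such integer. If \<open>\<tau>\<close> is an
    integer, \<open>Q\<close> is itself a lattice point and has to be skipped.\<close>
  define D where "D = Y + b + (\<lceil>\<tau>\<rceil> - 1) *s u"
  have dQ: "dist (emb (Y + b + j *s u)) Q = \<bar>of_int j - \<tau>\<bar> * norm (emb u)" for j
    by (simp add: Q_def emb_simps dist_norm flip: scaleR_left_diff_distrib)
  have "emb D = emb (Y + b) + of_int (\<lceil>\<tau>\<rceil> - 1) *\<^sub>R emb u"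
    unfolding D_def emb_simps ..
  then have D_l: "emb D \<in> l" unfolding l_def by blast
  have D_min: "is_arg_min (\<lambda>P. dist (emb P) Q) (\<lambda>P. emb P \<in> l \<and> osign X Y Z * osign P Y Z < 0) D"
    unfolding is_arg_min_def
  proof (intro conjI notI)
    show "osign X Y Z * osign D Y Z < 0" unfolding D_def side by linarith
    assume "\<exists>P. (emb P \<in> l \<and> osign X Y Z * osign P Y Z < 0) \<and> dist (emb P) Q < dist (emb D) Q"
    then obtain P where P: "emb P \<in> l" "osign X Y Z * osign P Y Z < 0" "dist (emb P) Q < dist (emb D) Q"
      by blast
    obtain j where j: "P = Y + b + j *s u" using on_l P(1) by blast
    have jt: "of_int j < \<tau>" using P(2) j side by simp
    then have "j \<le> \<lceil>\<tau>\<rceil> - 1" by linarith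
    then have "\<bar>of_int (\<lceil>\<tau>\<rceil> - 1) - \<tau>\<bar> \<le> \<bar>of_int j - \<tau>\<bar>" using jt by linarith
    then show False using P(3) unfolding j D_def dQ
      by (meson linorder_not_less mult_right_mono norm_ge_zero)
  qed (rule D_l)
  have Dc: "cross u (D - Y) = s" by (simp add: D_def cross_simps b)
  obtain x1 where x1: "v = x1 *s u + \<bar>c\<bar> *s (D - Y)"
  proof -
    have "s *s v = cross v (D - Y) *s u + c *s (D - Y)"
      using cramer[of u "D - Y" v] by (simp add: Dc c_def)
    then have "s *s (s *s v) = (s * cross v (D - Y)) *s u + (s * c) *s (D - Y)"
      by (simp add: vector_add_ldistrib vector_smult_assoc)
    then have "v = (s * cross v (D - Y)) *s u + \<bar>c\<bar> *s (D - Y)"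
      by (simp add: vector_smult_assoc sc)
    then show thesis using that by blast
  qed
  have "lsin X Y Z = \<bar>c\<bar>"
    unfolding lsin_def
  proof (rule the_equality)
    show "\<exists>x1 l Q D. l \<in> unit_lines Y X \<and> Q \<in> l \<and> Q \<in> ray Y Z \<and>
      is_arg_min (\<lambda>P. dist (emb P) Q) (\<lambda>P. emb P \<in> l \<and> osign X Y Z * osign P Y Z < 0) D \<and>
      prim_vec Y Z = x1 *s prim_vec Y X + \<bar>c\<bar> *s (D - Y)"
      using l_in Q_ray D_min x1 unfolding u_def[symmetric] v_def[symmetric]
      by (intro exI[of _ x1] exI[of _ l] exI[of _ Q] exI[of _ D]) (auto simp: l_def Q_def)
  next
    fix x2
    assume "\<exists>x1 l Q D. l \<in> unit_lines Y X \<and> Q \<in> l \<and> Q \<in> ray Y Z \<and>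
      is_arg_min (\<lambda>P. dist (emb P) Q) (\<lambda>P. emb P \<in> l \<and> osign X Y Z * osign P Y Z < 0) D \<and>
      prim_vec Y Z = x1 *s prim_vec Y X + x2 *s (D - Y)"
    then obtain x1 l Q D where
      h: "l \<in> unit_lines Y X" "Q \<in> l" "Q \<in> ray Y Z" "emb D \<in> l"
         "v = x1 *s u + x2 *s (D - Y)"
      unfolding u_def v_def is_arg_min_def by blast
    obtain P where P: "\<bar>cross u (P - Y)\<bar> = 1" "l = {emb P + t *\<^sub>R emb u | t. True}"
      using h(1) unfolding unit_lines_def u_def[symmetric] lattice_basis_iff_cross by blast
    have l_cross: "rcross (emb u) (R - emb Y) = of_int (cross u (P - Y))" if R: "R \<in> l" for R
    proof -
      obtain t where "R = emb P + t *\<^sub>R emb u" using R P(2) by blast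
      then have "R - emb Y = emb (P - Y) + t *\<^sub>R emb u" by (simp add: emb_simps)
      then show ?thesis by (simp add: rcross_simps rcross_emb)
    qed
    obtain t where t: "t \<ge> 0" "Q - emb Y = t *\<^sub>R emb (n *s v)"
      using h(3) unfolding ray_def by (auto simp: n(3)[symmetric] emb_simps(2))
    \<comment> \<open>Since \<open>t\<close> is nonnegative, the line met by the ray is the one
      whose determinant has the sign of \<open>c\<close>.\<close>
    have "of_int (cross u (P - Y)) = (t * of_int n) * (of_int c :: real)"
      using l_cross[OF h(2)] by (simp add: t emb_simps(3) rcross_simps rcross_emb c_def)
    then have "sgn (of_int (cross u (P - Y)) :: real) = sgn (t * of_int n) * sgn (of_int c)"
      by (simp add: sgn_mult)
    moreover have "sgn (t * of_int n) \<ge> 0" using t(1) n(1) by (simp add: sgn_if)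
    ultimately have Ps: "cross u (P - Y) = s"
      using P(1) c0 unfolding s_def by (auto simp: sgn_if abs_if split: if_splits)
    have "cross u (D - Y) = s"
      using l_cross[OF h(4)] by (simp add: emb_simps(2)[symmetric] rcross_emb Ps)
    then have "c = x2 * s" unfolding c_def h(5) cross_simps(2,6,9) by simp
    then show "x2 = \<bar>c\<bar>" using sc by (metis mult.assoc mult.commute mult_1)
  qed
  then show ?thesis by (simp add: c_def u_def v_def)
qed

subsection \<open>Broken lines and their length-sine sequences\<close>

lemma broken_line_Cons2 [simp]: "broken_line [A, B] \<longleftrightarrow> A \<noteq> B"
  by (auto simp: broken_line_def)

lemma broken_line_Cons3 [simp]:
  "broken_line (A # B # C # As) \<longleftrightarrow>
     A \<noteq> B \<and> cross (A - B) (C - B) \<noteq> 0 \<and> broken_line (B # C # As)"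
proof -
  have all_split: "(\<forall>i. P i) \<longleftrightarrow> P 0 \<and> (\<forall>i. P (Suc i))" for P :: "nat \<Rightarrow> bool"
    by (metis nat.exhaust)
  show ?thesis
    unfolding broken_line_def collinear_emb_iff by (subst (1 2) all_split) auto
qed

lemma unit_distance_single [simp]: "unit_distance V [A]"
  by (simp add: unit_distance_def)

lemma unit_distance_Cons2 [simp]:
  "unit_distance V (A # B # As) \<longleftrightarrow>
     \<bar>cross (prim_vec A B) (V - A)\<bar> = 1 \<and> unit_distance V (B # As)"
proof -
  have all_split: "(\<forall>i. P i) \<longleftrightarrow> P 0 \<and> (\<forall>i. P (Suc i))" for P :: "nat \<Rightarrow> bool"
    by (metis nat.exhaust)
  show ?thesis
    unfolding unit_distance_def lattice_basis_iff_cross by (subst all_split) auto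
qed

lemma signed_length_sine_Cons2:
  "signed_length_sine V [A, B] = [osign A V B * int (lattice_length A B)]"
  by (simp add: signed_length_sine_def upt_rec)

lemma signed_length_sine_Cons3:
  "signed_length_sine V (A # B # C # As) =
     osign A V B * int (lattice_length A B) #
     osign A V B * osign B V C * osign A B C * lsin A B C #
     signed_length_sine V (B # C # As)"
proof -
  have upt_split: "[0..<Suc (Suc n)] = 0 # 1 # map (\<lambda>j. j + 2) [0..<n]" for n
    by (induction n) auto
  have "[0..<2 * (length (A # B # C # As) - 1) - 1] =
      0 # 1 # map (\<lambda>j. j + 2) [0..<2 * (length (B # C # As) - 1) - 1]"
    using upt_split[of "2 * (length (B # C # As) - 1) - 1"] by simp
  then show ?thesis
    unfolding signed_length_sine_def by (simp add: Let_def o_def)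
qed

text \<open>Since \<open>w\<close> is primitive, \<open>B - A\<close> is
  \<open>\<bar>a\<bar>\<close> times the primitive vector \<open>sgn a *s w\<close>; the orientation
  sign seen from the origin is \<open>sgn a\<close>, which turns the length
  \<open>\<bar>a\<bar>\<close> back into \<open>a\<close>.\<close>

lemma unit_step:
  assumes "cross A w = 1" "B = A + a *s w" "a \<noteq> 0"
  shows "A \<noteq> B" "prim_vec A B = sgn a *s w" "prim_vec B A = - sgn a *s w" "cross B w = 1"
    "\<bar>cross (prim_vec A B) A\<bar> = 1" "osign A 0 B * int (lattice_length A B) = a"
    "osign A 0 B = sgn a"
proof -
  show "A \<noteq> B" using assms by (auto simp: cross_simps)
  have "\<bar>cross (sgn a *s w) A\<bar> = 1" "\<bar>cross (- sgn a *s w) A\<bar> = 1"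
    using assms by (simp_all add: cross_simps cross_swap[of w] abs_mult)
  then have p: "primitive (sgn a *s w)" "primitive (- sgn a *s w)"
    by (blast intro: primitive_if_abs_cross)+
  have e: "B - A = \<bar>a\<bar> *s (sgn a *s w)" "A - B = \<bar>a\<bar> *s (- sgn a *s w)"
    using assms by (simp_all add: vector_smult_assoc abs_mult_sgn lpoint_eq_iff mult.assoc[symmetric])
  show pv: "prim_vec A B = sgn a *s w" "prim_vec B A = - sgn a *s w"
    using p e assms(3) by (auto intro!: prim_vec_eqI[of _ "\<bar>a\<bar>"])
  show "\<bar>cross (prim_vec A B) A\<bar> = 1" unfolding pv by fact
  show "cross B w = 1" using assms by (simp add: cross_simps)
  show o: "osign A 0 B = sgn a" using assms by (simp add: osign_eq_cross cross_simps)
  have "lattice_length A B = nat \<bar>a\<bar>"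
    using lattice_length_eq[OF p(1) _ e(1)] assms(3) by simp
  then show "osign A 0 B * int (lattice_length A B) = a" by (simp add: o abs_mult_sgn mult.commute)
qed

text \<open>The new direction satisfies \<open>cross w w' = - c\<close>. In the product of the three
  orientation signs \<open>sgn a\<close> and \<open>sgn b\<close> each occur twice and cancel, so
  the signed sine is exactly the coefficient \<open>c\<close>.\<close>

lemma unit_step_sine:
  assumes "cross A w = 1" "B = A + a *s w" "a \<noteq> 0" "C = B + b *s (w + c *s B)" "b \<noteq> 0"
  shows "cross (A - B) (C - B) = a * b * c"
    "c \<noteq> 0 \<Longrightarrow> osign A 0 B * osign B 0 C * osign A B C * lsin A B C = c"
proof -
  define w' where "w' = w + c *s B"
  have Bw: "cross B w = 1" using unit_step[OF assms(1-3)] by simp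
  then have Bw': "cross B w' = 1" by (simp add: w'_def cross_simps)
  have C: "C = B + b *s w'" using assms w'_def by simp
  have ww': "cross w w' = - c" using Bw by (simp add: w'_def cross_simps cross_swap[of w B])
  have "A - B = (- a) *s w" "C - B = b *s w'"
    using assms(2) C by (simp_all add: lpoint_eq_iff)
  then show x: "cross (A - B) (C - B) = a * b * c" by (simp add: cross_simps ww')
  assume c: "c \<noteq> 0"
  have "lsin A B C = \<bar>cross (- sgn a *s w) (sgn b *s w')\<bar>"
    using lsin_eq_abs_cross[of A B C] unit_step(3)[OF assms(1-3)] unit_step(2)[OF Bw' C assms(5)]
      x c assms by simp
  also have "\<dots> = \<bar>c\<bar>" using assms by (simp add: cross_simps ww' abs_mult)
  finally have l: "lsin A B C = \<bar>c\<bar>" .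
  have "sgn a * sgn b * sgn (a * b * c) * \<bar>c\<bar> = (sgn a * sgn a) * (sgn b * sgn b) * (sgn c * \<bar>c\<bar>)"
    by (simp only: sgn_mult mult_ac)
  also have "\<dots> = c" using assms(3,5) by (auto simp: sgn_if)
  finally have "sgn a * sgn b * sgn (a * b * c) * \<bar>c\<bar> = c" .
  then show "osign A 0 B * osign B 0 C * osign A B C * lsin A B C = c"
    by (simp add: l osign_eq_cross[of A B C] x unit_step(7)[OF assms(1-3)] unit_step(7)[OF Bw' C assms(5)])
qed

text \<open>With the vertex at the origin, a segment \<open>A B\<close> on unit distance is encoded by \<open>w\<close> with
  \<open>cross A w = 1\<close> and \<open>B = A + a *s w\<close>; then \<open>a\<close> is its signed length, and the
  next direction is \<open>w + c *s B\<close> where \<open>c\<close> is the signed sine at \<open>B\<close>.\<close>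

fun build :: "lpoint \<Rightarrow> lpoint \<Rightarrow> int list \<Rightarrow> lpoint list" where
  "build A w [] = [A]"
| "build A w [a] = [A, A + a *s w]"
| "build A w (a # c # S) = A # build (A + a *s w) (w + c *s (A + a *s w)) S"

lemma build_hd: "build A w S = A # tl (build A w S)"
  by (cases "(A, w, S)" rule: build.cases) auto

lemma hd_build [simp]: "hd (build A w S) = A"
  by (subst build_hd) simp

lemma build_not_Nil [simp]: "build A w S \<noteq> []"
  by (subst build_hd) simp

lemma build_second: "S \<noteq> [] \<Longrightarrow> build A w S = A # (A + hd S *s w) # tl (tl (build A w S))"
  by (cases "(A, w, S)" rule: build.cases) (auto simp: build_hd[symmetric] hd_build intro: build_hd)

lemma build_line:
  assumes "cross A w = 1" "odd (length S)" "0 \<notin> set S"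
  shows "broken_line (build A w S) \<and> unit_distance 0 (build A w S) \<and>
         signed_length_sine 0 (build A w S) = S"
  using assms
proof (induction A w S rule: build.induct)
  case (2 A w a)
  then show ?case
    using unit_step[OF 2(1) refl, of a] by (simp add: signed_length_sine_Cons2 cross_simps)
next
  case (3 A w a c S)
  define B where "B = A + a *s w"
  define w' where "w' = w + c *s B"
  have "S \<noteq> []" using 3(3) by auto
  then have "hd S \<in> set S" by simp
  then have nz: "a \<noteq> 0" "c \<noteq> 0" "S \<noteq> []" "hd S \<noteq> 0" using 3(4) \<open>S \<noteq> []\<close> by (auto simp del: hd_in_set)
  have s1: "cross B w' = 1" using unit_step(4)[OF 3(2) B_def nz(1)] by (simp add: w'_def cross_simps)
  define C where "C = B + hd S *s w'"
  obtain L where L: "build B w' S = B # C # L"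
    using build_second[OF nz(3), of B w'] C_def by metis
  have ih: "broken_line (B # C # L) \<and> unit_distance 0 (B # C # L) \<and>
         signed_length_sine 0 (B # C # L) = S"
    using 3(1) 3(3-) s1 unfolding B_def[symmetric] w'_def[symmetric] L by auto
  have b: "build A w (a # c # S) = A # B # C # L" by (simp add: B_def[symmetric] w'_def[symmetric] L)
  note us = unit_step[OF 3(2) B_def nz(1)]
    unit_step_sine[OF 3(2) B_def nz(1) C_def[unfolded w'_def] nz(4)]
  show ?case unfolding b
    using us ih nz by (simp add: signed_length_sine_Cons3 cross_simps)
qed simp

text \<open>At the vertex \<open>B\<close> the old and the new direction both have determinant 1
  with \<open>B\<close>, so they differ by a multiple of \<open>B\<close>. The factor is the sine,
  and it is nonzero because consecutive segments are not collinear.\<close>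

lemma build_unique:
  assumes "cross A w = 1" "B = A + t *s w"
    "broken_line (A # B # As)" "unit_distance 0 (A # B # As)"
  shows "A # B # As = build A w (signed_length_sine 0 (A # B # As))"
  using assms
proof (induction As arbitrary: A B w t)
  case Nil
  then have "t \<noteq> 0" by auto
  then show ?case using unit_step(6)[OF Nil(1,2)] Nil by (simp add: signed_length_sine_Cons2)
next
  case (Cons C As)
  have AB: "A \<noteq> B" using Cons(4) by simp
  then have t: "t \<noteq> 0" using Cons(3) by auto
  note us = unit_step[OF Cons(2,3) t]
  have BC: "B \<noteq> C" using Cons(4) by (auto simp: cross_simps)
  obtain m where m: "m > 0" "C - B = m *s prim_vec B C" using prim_vec_props[OF BC] by metis
  \<comment> \<open>The primitive vector along the segment may have determinant 1 or -1 with
    \<open>B\<close>; multiplying by \<open>s\<close> normalises it to 1 and moves the sign into the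
    signed length.\<close>
  define s where "s = cross B (prim_vec B C)"
  have s: "\<bar>s\<bar> = 1" using Cons(5) by (simp add: s_def cross_simps cross_swap[of "prim_vec B C"])
  then have ss: "s * s = 1" by (metis abs_mult_self_eq mult_1)
  define w' where "w' = s *s prim_vec B C"
  have Bw': "cross B w' = 1" using ss by (simp add: w'_def s_def[symmetric] cross_simps)
  define b where "b = m * s"
  have "C - B = b *s w'" by (simp add: m b_def w'_def vector_smult_assoc mult.assoc ss)
  then have C: "C = B + b *s w'" by (simp add: algebra_simps)
  have b0: "b \<noteq> 0" using BC C by auto
  have "cross B (w' - w) = 0" using Bw' us(4) by (simp add: cross_simps)
  from parallel_to_primitive[OF us(4) this] obtain c where "w' - w = c *s B" by blast
  then have w': "w' = w + c *s B" by (simp add: algebra_simps)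
  note us2 = unit_step_sine[OF Cons(2,3) t C[unfolded w'] b0]
  have c0: "c \<noteq> 0" using us2(1) Cons(4) by auto
  have "B # C # As = build B w' (signed_length_sine 0 (B # C # As))"
    using Cons(1)[OF Bw' C] Cons(4,5) by simp
  moreover have "signed_length_sine 0 (A # B # C # As) = t # c # signed_length_sine 0 (B # C # As)"
    using us us2(2)[OF c0] by (simp add: signed_length_sine_Cons3)
  ultimately show ?case using w' Cons(3) by simp
qed

text \<open>That the second vertex lies on the line \<open>x = 1\<close> fixes the first direction
  as \<open>vector [0, 1]\<close>; existence and uniqueness of the generated line then evaluate the
  definite description.\<close>

lemma Phi_eq_build:
  assumes "odd (length S)" "0 \<notin> set S"
  shows "Phi S = angle 0 (build (vector [1, 0]) (vector [0, 1]) S)"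
proof -
  let ?A = "vector [1, 0] :: lpoint" and ?w = "vector [0, 1] :: lpoint"
  have cw: "cross ?A ?w = 1" by (simp add: cross_def)
  have S: "S \<noteq> []" using assms by auto
  have "(THE As. broken_line As \<and> unit_distance 0 As \<and>
     As ! 0 = ?A \<and> (As ! 1) $ 1 = 1 \<and> signed_length_sine 0 As = S) = build ?A ?w S"
  proof (rule the_equality)
    have "build ?A ?w S ! 0 = ?A" by (subst build_hd) simp
    moreover have "(build ?A ?w S ! 1) $ 1 = 1" by (subst build_second[OF S]) simp
    ultimately show "broken_line (build ?A ?w S) \<and> unit_distance 0 (build ?A ?w S) \<and>
       build ?A ?w S ! 0 = ?A \<and> (build ?A ?w S ! 1) $ 1 = 1 \<and>
       signed_length_sine 0 (build ?A ?w S) = S"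
      using build_line[OF cw assms] by simp
  next
    fix As assume h: "broken_line As \<and> unit_distance 0 As \<and>
       As ! 0 = ?A \<and> (As ! 1) $ 1 = 1 \<and> signed_length_sine 0 As = S"
    then have "2 \<le> length As" by (simp add: broken_line_def)
    then obtain A B L where As: "As = A # B # L"
      by (metis Suc_le_length_iff numeral_2_eq_2)
    have A: "A = ?A" and B: "B = ?A + (B$2) *s ?w" using h As by (auto simp: lpoint_eq_iff)
    show "As = build ?A ?w S"
      using build_unique[OF cw B, of L] h unfolding As A by metis
  qed
  then show ?thesis by (simp add: Phi_def)
qed

subsection \<open>Total turn and homotopy\<close>

definition to_complex :: "real^2 \<Rightarrow> complex" where
  "to_complex x = Complex (x$1) (x$2)"

definition cpoint :: "lpoint \<Rightarrow> complex" where
  "cpoint P = Complex (of_int (P$1)) (of_int (P$2))"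

lemma to_complex_emb [simp]: "to_complex (emb P) = cpoint P"
  by (simp add: to_complex_def cpoint_def emb_def)

lemma cpoint_eq_0_iff [simp]: "cpoint P = 0 \<longleftrightarrow> P = 0"
  by (auto simp: cpoint_def complex_eq_iff lpoint_eq_iff)

lemma cpoint_simps [simp]:
  "Re (cpoint P) = of_int (P$1)" "Im (cpoint P) = of_int (P$2)" "cpoint (- P) = - cpoint P"
  by (simp_all add: cpoint_def complex_eq_iff)

lemma to_complex_linepath: "to_complex \<circ> linepath x y = linepath (to_complex x) (to_complex y)"
  by (rule ext) (simp add: to_complex_def linepath_def complex_eq_iff)

lemma continuous_on_to_complex: "continuous_on S to_complex"
proof -
  have eq: "to_complex = (\<lambda>x. of_real (x$1) + \<i> * of_real (x$2))"
    by (rule ext) (simp add: to_complex_def complex_eq_iff)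
  show ?thesis unfolding eq by (intro continuous_intros)
qed

lemma null_homotopic_iff_winding_number:
  assumes "path (to_complex \<circ> p)" "0 \<notin> path_image (to_complex \<circ> p)"
  shows "(\<exists>c. homotopic_loops (UNIV - {0}) p (linepath c c)) \<longleftrightarrow>
         winding_number (to_complex \<circ> p) 0 = 0"
proof -
  define g :: "complex \<Rightarrow> real^2" where "g z = vector [Re z, Im z]" for z
  have g: "g (to_complex x) = x" "to_complex (g z) = z" for x z
    by (simp_all add: g_def to_complex_def vec_eq_iff forall_2)
  have cg: "continuous_on S g" for S
  proof -
    have "g = (\<lambda>z. Re z *\<^sub>R vector [1, 0] + Im z *\<^sub>R vector [0, 1])"
      by (rule ext) (simp add: g_def vec_eq_iff forall_2)
    then show ?thesis by (simp only:) (intro continuous_intros)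
  qed
  have z: "to_complex x = 0 \<longleftrightarrow> x = 0" "g y = 0 \<longleftrightarrow> y = 0" for x y
    by (auto simp: g_def to_complex_def complex_eq_iff vec_eq_iff forall_2)
  have gp: "g \<circ> (to_complex \<circ> p) = p" by (rule ext) (simp add: g)
  have "(\<exists>c. homotopic_loops (UNIV - {0}) p (linepath c c)) \<longleftrightarrow>
        (\<exists>a. homotopic_loops (-{0}) (to_complex \<circ> p) (\<lambda>t. a))" (is "?l \<longleftrightarrow> ?r")
  proof
    assume ?l
    then obtain c where "homotopic_loops (UNIV - {0}) p (linepath c c)" by blast
    then have "homotopic_loops (-{0}) (to_complex \<circ> p) (to_complex \<circ> linepath c c)"
      by (rule homotopic_loops_continuous_image[OF _ continuous_on_to_complex]) (auto simp: z)
    then show ?r by (auto simp: linepath_refl o_def)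
  next
    assume ?r
    then obtain a where "homotopic_loops (-{0}) (to_complex \<circ> p) (\<lambda>t. a)" by blast
    then have "homotopic_loops (UNIV-{0}) (g \<circ> (to_complex \<circ> p)) (g \<circ> (\<lambda>t. a))"
      by (rule homotopic_loops_continuous_image[OF _ cg]) (auto simp: z)
    then show ?l unfolding gp by (auto simp: linepath_refl o_def)
  qed
  then show ?thesis using winding_number_homotopic_loops_null_eq[OF assms] by simp
qed

text \<open>For an open path the winding number is complex, and its imaginary part records the
  change of modulus. The real part for a segment is below 1/2 in absolute value, which singles out
  the principal argument.\<close>

lemma Re_winding_number_linepath:
  assumes "0 \<notin> closed_segment z w"
  shows "2 * pi * Re (winding_number (linepath z w) 0) = Arg (w / z)"
proof (rule cis_Arg_unique[symmetric])
  let ?n = "winding_number (linepath z w) 0"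
  have "z \<noteq> 0" using assms by auto
  moreover have "w = exp (2 * pi * \<i> * ?n) * z"
    using winding_number_exp_2pi[of "linepath z w" 0] assms by simp
  ultimately have "w / z = exp (2 * pi * \<i> * ?n)" by (metis nonzero_eq_divide_eq)
  then show "sgn (w / z) = cis (2 * pi * Re ?n)"
    by (simp add: exp_eq_polar sgn_mult sgn_of_real)
  have "\<bar>Re ?n\<bar> < 1/2" using winding_number_lt_half_linepath[OF assms] .
  then have "\<bar>2 * pi * Re ?n\<bar> < pi" by (simp add: abs_mult)
  then show "- pi < 2 * pi * Re ?n" "2 * pi * Re ?n \<le> pi" by linarith+
qed

text \<open>Principal arguments suffice segment by segment, because a segment that avoids the origin
  is seen from it under an angle less than \<open>pi\<close>.\<close>

fun turn :: "lpoint list \<Rightarrow> real" where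
  "turn [] = 0"
| "turn [A] = 0"
| "turn (A # B # As) = Arg (cpoint B / cpoint A) + turn (B # As)"

fun steps_apart :: "lpoint list \<Rightarrow> bool" where
  "steps_apart [] = False"
| "steps_apart [A] \<longleftrightarrow> A \<noteq> 0"
| "steps_apart (A # B # As) \<longleftrightarrow> cross A B \<noteq> 0 \<and> steps_apart (B # As)"

lemma zero_notin_segment:
  assumes "cross A B \<noteq> 0"
  shows "0 \<notin> closed_segment (cpoint A) (cpoint B)"
proof
  assume "0 \<in> closed_segment (cpoint A) (cpoint B)"
  then obtain s where s: "0 = (1 - s) *\<^sub>R cpoint A + s *\<^sub>R cpoint B"
    by (auto simp: closed_segment_def)
  then have 1: "(1 - s) * of_int (A$1) + s * of_int (B$1) = 0"
        and 2: "(1 - s) * of_int (A$2) + s * of_int (B$2) = 0"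
    by (auto simp: complex_eq_iff)
  have "s * of_int (cross A B) =
      of_int (A$1) * ((1 - s) * of_int (A$2) + s * of_int (B$2)) -
      of_int (A$2) * ((1 - s) * of_int (A$1) + s * of_int (B$1))"
    by (simp add: cross_def algebra_simps)
  then have "s = 0" using assms 1 2 by simp
  then have "A = 0" using 1 2 by (simp add: lpoint_eq_iff)
  then show False using assms by (simp add: cross_simps)
qed

lemma broken_path_props:
  assumes "steps_apart As"
  shows "path (to_complex \<circ> broken_path As) \<and> 0 \<notin> path_image (to_complex \<circ> broken_path As) \<and>
    pathstart (to_complex \<circ> broken_path As) = cpoint (hd As) \<and>
    pathfinish (to_complex \<circ> broken_path As) = cpoint (last As) \<and>
    2 * pi * Re (winding_number (to_complex \<circ> broken_path As) 0) = turn As"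
  using assms
proof (induction As rule: broken_path.induct)
  case (1 A)
  then show ?case unfolding broken_path.simps to_complex_linepath to_complex_emb
    by (simp del: linepath_trivial)
next
  case (2 A B)
  then have "0 \<notin> closed_segment (cpoint A) (cpoint B)" by (simp add: zero_notin_segment)
  then show ?case by (simp add: to_complex_linepath Re_winding_number_linepath)
next
  case (3 A B C As)
  then have z: "0 \<notin> closed_segment (cpoint A) (cpoint B)" and sa: "steps_apart (B # C # As)"
    by (simp_all add: zero_notin_segment)
  define p where "p = to_complex \<circ> broken_path (B # C # As)"
  note ih = 3(1)[OF sa, folded p_def]
  show ?case
    unfolding broken_path.simps path_compose_join to_complex_linepath to_complex_emb p_def[symmetric]
    using z ih Re_winding_number_linepath[OF z]
    by (simp add: path_image_join winding_number_join ring_distribs)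
qed (use assms in auto)

text \<open>Along a segment the determinant with its primitive direction is constantly 1 or -1.
  Hence both ends are primitive, and \<open>cross A B\<close> is, up to sign, the positive length of
  the segment.\<close>

lemma unit_broken_line_props:
  assumes "unit_broken_line 0 As"
  shows "As \<noteq> [] \<and> steps_apart As \<and> (\<forall>A\<in>set As. primitive A)"
proof -
  have "steps_apart (A # B # As) \<and> (\<forall>P\<in>set (A # B # As). primitive P)"
    if "broken_line (A # B # As)" "unit_distance 0 (A # B # As)" for A B As
    using that
  proof (induction As arbitrary: A B)
    have *: "cross A B \<noteq> 0 \<and> primitive A \<and> primitive B \<and> B \<noteq> 0"
      if "A \<noteq> B" "\<bar>cross (prim_vec A B) (- A)\<bar> = 1" for A B
    proof -
      obtain m where m: "m > 0" "B - A = m *s prim_vec A B" using prim_vec_props \<open>A \<noteq> B\<close> by metis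
      then have B: "B = A + m *s prim_vec A B" by (metis add.commute diff_add_cancel)
      have c: "\<bar>cross A (prim_vec A B)\<bar> = 1" using that by (simp add: cross_simps cross_swap[of "prim_vec A B"])
      have c': "cross B (prim_vec A B) = cross A (prim_vec A B)"
        by (subst B) (simp add: cross_simps)
      have "cross A B = m * cross A (prim_vec A B)" by (subst B) (simp add: cross_simps)
      then show ?thesis using m(1) c c' primitive_if_abs_cross by (metis abs_zero cross_simps(10) less_irrefl mult_eq_0_iff zero_neq_one)
    qed
    {
      case Nil
      then show ?case using * by simp
    next
      case (Cons C As)
      then show ?case using *[of A B] Cons.IH[of B C] by simp
    }
  qed
  note main = this
  from assms consider "broken_line As" "unit_distance 0 As" | A where "As = [A]" "primitive (- A)"
    unfolding unit_broken_line_def by auto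
  then show ?thesis
  proof cases
    case 1
    then have "2 \<le> length As" by (simp add: broken_line_def)
    then obtain A B L where "As = A # B # L" by (metis Suc_le_length_iff numeral_2_eq_2)
    then show ?thesis using main 1 by simp
  next
    case 2
    then show ?thesis by (auto simp: primitive_def)
  qed
qed

text \<open>The winding number of the closed path is the difference of those of the two lines. It is
  an integer, so it vanishes iff its real part does, that is, iff the turns agree.\<close>

lemma line_equiv_iff_turn:
  "line_equiv 0 As Bs \<longleftrightarrow> unit_broken_line 0 As \<and> unit_broken_line 0 Bs \<and>
     hd As = hd Bs \<and> last As = last Bs \<and> turn As = turn Bs"
proof -
  have "(\<exists>c. homotopic_loops (UNIV - {emb 0})
            (broken_path As +++ reversepath (broken_path Bs)) (linepath c c)) \<longleftrightarrow> turn As = turn Bs"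
    if u: "unit_broken_line 0 As" "unit_broken_line 0 Bs" "hd As = hd Bs" "last As = last Bs"
  proof -
    let ?p = "to_complex \<circ> broken_path As" and ?q = "to_complex \<circ> broken_path Bs"
    note p = broken_path_props[OF unit_broken_line_props[OF u(1), THEN conjunct2, THEN conjunct1]]
    note q = broken_path_props[OF unit_broken_line_props[OF u(2), THEN conjunct2, THEN conjunct1]]
    let ?l = "?p +++ reversepath ?q"
    have e: "to_complex \<circ> (broken_path As +++ reversepath (broken_path Bs)) = ?l"
      by (simp add: path_compose_join path_compose_reversepath)
    have l: "path ?l" "0 \<notin> path_image ?l" "pathfinish ?l = pathstart ?l"
      using p q u by (auto simp: path_image_join)
    have w: "winding_number ?l 0 = winding_number ?p 0 - winding_number ?q 0"
      using p q u by (simp add: winding_number_join winding_number_reversepath)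
    have "winding_number ?l 0 \<in> \<int>" by (rule integer_winding_number[OF l(1,3,2)])
    then have "winding_number ?l 0 = 0 \<longleftrightarrow> Re (winding_number ?l 0) = 0"
      by (auto simp: complex_eq_iff elim!: Ints_cases)
    also have "\<dots> \<longleftrightarrow> 2 * pi * Re (winding_number ?p 0) = 2 * pi * Re (winding_number ?q 0)"
      by (simp add: w)
    also have "\<dots> \<longleftrightarrow> turn As = turn Bs" using p q by simp
    finally show ?thesis
      using null_homotopic_iff_winding_number[of "broken_path As +++ reversepath (broken_path Bs)"] l
      unfolding e by simp
  qed
  then show ?thesis unfolding line_equiv_def by blast
qed

text \<open>The quotients of consecutive vertices telescope, so the end points determine the turn
  modulo \<open>2 * pi\<close>.\<close>

lemma cis_turn:
  assumes "steps_apart As"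
  shows "cis (turn As) = sgn (cpoint (last As) / cpoint (hd As))"
  using assms
proof (induction As rule: turn.induct)
  case (3 A B As)
  then have nz: "A \<noteq> 0" "B \<noteq> 0" by (auto simp: cross_simps)
  have "cis (turn (A # B # As)) = sgn (cpoint B / cpoint A) * sgn (cpoint (last (B # As)) / cpoint B)"
    using 3 nz by (simp add: cis_mult[symmetric] cis_Arg)
  also have "\<dots> = sgn (cpoint (last (B # As)) / cpoint A)"
    using nz by (subst sgn_mult[symmetric]) (simp del: last.simps)
  finally show ?case by simp
qed auto

text \<open>As long as the line stays in one closed half plane bounded by the \<open>x\<close>-axis, the differences
  of arguments add up without any correction by multiples of \<open>2 * pi\<close>.\<close>

lemma turn_half_plane:
  assumes "steps_apart As" "\<bar>s\<bar> = 1" "\<And>A. A \<in> set As \<Longrightarrow> s * A$2 \<ge> 0"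
  shows "turn As = Arg (cpoint (s *s last As)) - Arg (cpoint (s *s hd As))"
  using assms
proof (induction As rule: turn.induct)
  case (3 A B As)
  define a b where "a = cpoint (s *s A)" and "b = cpoint (s *s B)"
  have nz: "A \<noteq> 0" "B \<noteq> 0" using 3 by (auto simp: cross_simps)
  then have nz': "a \<noteq> 0" "b \<noteq> 0" using 3(3) by (auto simp: a_def b_def)
  have ab: "b / a = cpoint B / cpoint A"
  proof -
    from 3(3) have "s = 1 \<or> s = -1" by linarith
    then show ?thesis by (auto simp: a_def b_def vector_sneg_minus1[symmetric])
  qed
  have im: "Im a \<ge> 0" "Im b \<ge> 0"
    using 3(4)[of A] 3(4)[of B] by (simp_all add: a_def b_def flip: of_int_mult)
  then have arg: "0 \<le> Arg a" "Arg a \<le> pi" "0 \<le> Arg b" "Arg b \<le> pi"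
    using Im_Ln_pos_le[OF nz'(1)] Im_Ln_pos_le[OF nz'(2)] nz' by (simp_all add: Arg_eq_Im_Ln)
  have "cross A B \<noteq> 0" using 3 by simp
  have "Arg (b / a) = Arg b - Arg a"
  proof (rule cis_Arg_unique)
    show c: "sgn (b / a) = cis (Arg b - Arg a)"
      using nz' by (simp add: cis_divide[symmetric] cis_Arg sgn_divide)
    show "Arg b - Arg a \<le> pi" using arg by linarith
    \<comment> \<open>The value \<open>- pi\<close> is outside the range of \<open>Arg\<close>. It
      would need \<open>A\<close> and \<open>B\<close> on opposite rays of the
      \<open>x\<close>-axis, with the origin between them.\<close>
    show "- pi < Arg b - Arg a"
    proof (rule ccontr)
      assume "\<not> - pi < Arg b - Arg a"
      then have "Arg b = 0" "Arg a = pi" using arg by linarith+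
      then have "Im b = 0" "Im a = 0" using nz' by (simp_all add: Arg_eq_Im_Ln Im_Ln_eq_0 Im_Ln_eq_pi)
      then have "A$2 = 0" "B$2 = 0" using 3(3) by (auto simp: a_def b_def)
      then show False using \<open>cross A B \<noteq> 0\<close> by (simp add: cross_def)
    qed
  qed
  then show ?case using 3 ab by (simp add: a_def b_def)
qed (use assms in auto)

subsection \<open>Proper lattice-affine transformations\<close>

definition affine_map :: "int \<Rightarrow> int \<Rightarrow> int \<Rightarrow> int \<Rightarrow> lpoint \<Rightarrow> lpoint \<Rightarrow> lpoint" where
  "affine_map a b c d t P = vector [a * P$1 + b * P$2 + t$1, c * P$1 + d * P$2 + t$2]"

lemma affine_map_nth [simp]:
  "affine_map a b c d t P $ 1 = a * P$1 + b * P$2 + t$1"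
  "affine_map a b c d t P $ 2 = c * P$1 + d * P$2 + t$2"
  by (simp_all add: affine_map_def)

lemma proper_lattice_affine_iff:
  "proper_lattice_affine f \<longleftrightarrow> (\<exists>a b c d t. a * d - b * c = 1 \<and> f = affine_map a b c d t)"
proof
  assume "proper_lattice_affine f"
  then obtain M :: "int^2^2" and t where M: "det M = 1" "f = (\<lambda>x. M *v x + t)"
    unfolding proper_lattice_affine_def by blast
  have "f = affine_map (M$1$1) (M$1$2) (M$2$1) (M$2$2) t"
    by (rule ext) (simp add: M(2) lpoint_eq_iff matrix_vector_mult_def sum_2)
  then show "\<exists>a b c d t. a * d - b * c = 1 \<and> f = affine_map a b c d t"
    using M(1) unfolding det_2 by blast
next
  assume "\<exists>a b c d t. a * d - b * c = 1 \<and> f = affine_map a b c d t"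
  then obtain a b c d t where h: "a * d - b * c = 1" "f = affine_map a b c d t" by blast
  define M :: "int^2^2" where "M = vector [vector [a, b], vector [c, d]]"
  define N :: "int^2^2" where "N = vector [vector [d, -b], vector [-c, a]]"
  have "M ** N = mat 1" "N ** M = mat 1"
    using h(1) by (simp_all add: M_def N_def vec_eq_iff forall_2 matrix_matrix_mult_def sum_2 mat_def algebra_simps)
  then have "invertible M" unfolding invertible_def by blast
  moreover have "det M = 1" using h(1) by (simp add: M_def det_2)
  moreover have "f = (\<lambda>x. M *v x + t)"
    by (rule ext) (simp add: h(2) M_def lpoint_eq_iff matrix_vector_mult_def sum_2)
  ultimately show "proper_lattice_affine f" unfolding proper_lattice_affine_def by blast
qed

lemma proper_lattice_affine_comp:
  assumes "proper_lattice_affine f" "proper_lattice_affine g"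
  shows "proper_lattice_affine (g \<circ> f)"
proof -
  obtain a b c d t where f: "a * d - b * c = 1" "f = affine_map a b c d t"
    using assms(1) proper_lattice_affine_iff by blast
  obtain a' b' c' d' t' where g: "a' * d' - b' * c' = 1" "g = affine_map a' b' c' d' t'"
    using assms(2) proper_lattice_affine_iff by blast
  have "g \<circ> f = affine_map (a'*a + b'*c) (a'*b + b'*d) (c'*a + d'*c) (c'*b + d'*d) (g t)"
    by (rule ext) (simp add: f g lpoint_eq_iff algebra_simps)
  moreover have "(a'*a + b'*c) * (c'*b + d'*d) - (a'*b + b'*d) * (c'*a + d'*c)
      = (a * d - b * c) * (a' * d' - b' * c')"
    by (simp add: algebra_simps)
  ultimately show ?thesis unfolding proper_lattice_affine_iff using f(1) g(1) by (metis mult_1)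
qed

lemma proper_lattice_affine_inverse:
  assumes "proper_lattice_affine f"
  obtains g where "proper_lattice_affine g" "\<And>x. g (f x) = x" "\<And>x. f (g x) = x"
proof -
  obtain a b c d t where f: "a * d - b * c = 1" "f = affine_map a b c d t"
    using assms(1) proper_lattice_affine_iff by blast
  \<comment> \<open>The adjugate matrix, with minus its value at \<open>t\<close> as translation
    vector.\<close>
  define g where "g = affine_map d (-b) (-c) a (vector [b * t$2 - d * t$1, c * t$1 - a * t$2])"
  have ad: "a * d = 1 + b * c" using f(1) by simp
  have e: "a * (d * x) = x + b * (c * x)" "d * (a * x) = x + b * (c * x)" for x
    by (metis ad distrib_right mult.assoc mult.commute mult_1)+
  have "proper_lattice_affine g"
    unfolding proper_lattice_affine_iff g_def using f(1)
    by (intro exI conjI) (auto simp: algebra_simps)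
  moreover have "g (f x) = x" "f (g x) = x" for x
    unfolding g_def f(2) lpoint_eq_iff
    by (simp_all add: algebra_simps e)
  ultimately show thesis using that by blast
qed

lemma proper_lattice_affine_linear:
  assumes "proper_lattice_affine f"
  obtains L where "\<And>x y. f x - f y = L (x - y)" "\<And>m u. L (m *s u) = m *s L u"
    "\<And>u v. cross (L u) (L v) = cross u v"
proof -
  obtain a b c d t where f: "a * d - b * c = 1" "f = affine_map a b c d t"
    using assms(1) proper_lattice_affine_iff by blast
  define L where "L = affine_map a b c d 0"
  have "cross (L u) (L v) = cross u v" for u v
  proof -
    have "cross (L u) (L v) = (a * d - b * c) * cross u v"
      by (simp add: L_def cross_def algebra_simps)
    then show ?thesis using f by simp
  qed
  moreover have "f x - f y = L (x - y)" "L (m *s u) = m *s L u" for x y m u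
    by (simp_all add: f L_def lpoint_eq_iff algebra_simps)
  ultimately show thesis using that by blast
qed

text \<open>Homotopies live in the real plane, so \<open>f\<close> is extended there. Affinity
  carries segments to segments, and injectivity keeps paths away from the image of the
  vertex.\<close>

lemma proper_lattice_affine_real:
  assumes "proper_lattice_affine f"
  obtains F where "\<And>P. F (emb P) = emb (f P)" "\<And>x y. F \<circ> linepath x y = linepath (F x) (F y)"
    "continuous_on UNIV F" "inj F"
proof -
  obtain a b c d t where f: "a * d - b * c = 1" "f = affine_map a b c d t"
    using assms(1) proper_lattice_affine_iff by blast
  define F :: "real^2 \<Rightarrow> real^2" where
    "F x = (of_int a * x$1 + of_int b * x$2) *\<^sub>R vector [1, 0]
         + (of_int c * x$1 + of_int d * x$2) *\<^sub>R vector [0, 1] + emb t" for x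
  have "F (emb P) = emb (f P)" for P
    by (simp add: F_def f emb_def vec_eq_iff forall_2)
  moreover have "F \<circ> linepath x y = linepath (F x) (F y)" for x y
    by (rule ext) (simp add: F_def linepath_def vec_eq_iff forall_2 algebra_simps)
  moreover have "continuous_on UNIV F" unfolding F_def by (intro continuous_intros)
  moreover have "inj F"
  proof (rule injI)
    fix x y assume "F x = F y"
    then have e: "of_int a * (x$1 - y$1) + of_int b * (x$2 - y$2) = 0"
      "of_int c * (x$1 - y$1) + of_int d * (x$2 - y$2) = 0"
      by (simp_all add: F_def vec_eq_iff forall_2 algebra_simps)
    have ad: "of_int a * of_int d - of_int b * of_int c = (1::real)"
      using f(1) by (metis of_int_1 of_int_diff of_int_mult)
    have "(of_int a * of_int d - of_int b * of_int c) * (x$1 - y$1) = 0"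
      "(of_int a * of_int d - of_int b * of_int c) * (x$2 - y$2) = 0"
      using e by algebra+
    then show "x = y" unfolding ad by (simp add: vec_eq_iff forall_2)
  qed
  ultimately show thesis using that by blast
qed

text \<open>Non-collinearity and unit distance are conditions on determinants of differences, and
  the linear part of \<open>f\<close> preserves these.\<close>

lemma unit_broken_line_map:
  assumes "proper_lattice_affine f" "unit_broken_line V As"
  shows "unit_broken_line (f V) (map f As)"
proof -
  obtain L where L: "\<And>x y. f x - f y = L (x - y)" "\<And>m u. L (m *s u) = m *s L u"
    "\<And>u v. cross (L u) (L v) = cross u v"
    using proper_lattice_affine_linear[OF assms(1)] by metis
  have prim: "primitive (L u)" if "primitive u" for u
    using that L(3) primitive_iff_cross by metis
  have inj: "f x = f y \<longleftrightarrow> x = y" for x y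
    using proper_lattice_affine_inverse[OF assms(1)] by metis
  have pv: "prim_vec (f A) (f B) = L (prim_vec A B)" if "A \<noteq> B" for A B
  proof -
    obtain m where "m > 0" "primitive (prim_vec A B)" "B - A = m *s prim_vec A B"
      using prim_vec_props \<open>A \<noteq> B\<close> by metis
    then show ?thesis using prim L by (intro prim_vec_eqI[of _ m]) auto
  qed
  from assms(2) consider "broken_line As" "unit_distance V As" | A where "As = [A]" "primitive (V - A)"
    unfolding unit_broken_line_def by auto
  then show ?thesis
  proof cases
    case 1
    then have "broken_line (map f As)"
      unfolding broken_line_def collinear_emb_iff by (simp add: inj L)
    moreover have "unit_distance (f V) (map f As)"
      using 1 unfolding broken_line_def unit_distance_def lattice_basis_iff_cross
      by (simp add: pv L)
    ultimately show ?thesis unfolding unit_broken_line_def by blast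
  next
    case 2
    then show ?thesis unfolding unit_broken_line_def using prim L by auto
  qed
qed

lemma unit_broken_line_not_Nil: "unit_broken_line V As \<Longrightarrow> As \<noteq> []"
  by (auto simp: unit_broken_line_def broken_line_def)

text \<open>Turns are of no help here, since a shear changes them and the vertex is arbitrary; the
  homotopy itself is composed with the real extension of \<open>f\<close>.\<close>

lemma line_equiv_map:
  assumes f: "proper_lattice_affine f" and eq: "line_equiv V As Bs"
  shows "line_equiv (f V) (map f As) (map f Bs)"
proof -
  obtain F where F: "\<And>P. F (emb P) = emb (f P)" "\<And>x y. F \<circ> linepath x y = linepath (F x) (F y)"
    "continuous_on UNIV F" "inj F"
    using proper_lattice_affine_real[OF f] by metis
  have bp: "F \<circ> broken_path Cs = broken_path (map f Cs)" if "Cs \<noteq> []" for Cs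
    using that by (induction Cs rule: broken_path.induct) (simp_all add: path_compose_join F del: linepath_trivial)
  have u: "unit_broken_line V As" "unit_broken_line V Bs" and ne: "As \<noteq> []" "Bs \<noteq> []"
    using eq unit_broken_line_not_Nil unfolding line_equiv_def by blast+
  obtain c where c: "homotopic_loops (UNIV - {emb V})
       (broken_path As +++ reversepath (broken_path Bs)) (linepath c c)"
    using eq unfolding line_equiv_def by blast
  have "continuous_on (UNIV - {emb V}) F" using F(3) continuous_on_subset by blast
  moreover have "F \<in> (UNIV - {emb V}) \<rightarrow> (UNIV - {emb (f V)})"
    using F(1,4) by (auto simp: inj_eq simp flip: F(1))
  ultimately have "homotopic_loops (UNIV - {emb (f V)})
       (F \<circ> (broken_path As +++ reversepath (broken_path Bs))) (F \<circ> linepath c c)"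
    using homotopic_loops_continuous_image[OF c] by blast
  then have "homotopic_loops (UNIV - {emb (f V)})
       (broken_path (map f As) +++ reversepath (broken_path (map f Bs))) (linepath (F c) (F c))"
    unfolding path_compose_join path_compose_reversepath bp[OF ne(1)] bp[OF ne(2)] F(2) .
  then show ?thesis
    unfolding line_equiv_def using unit_broken_line_map[OF f] u eq ne
    by (auto simp: line_equiv_def hd_map last_map)
qed

lemma proper_congruent_map:
  assumes f: "proper_lattice_affine f"
  shows "proper_congruent (angle V As) (angle (f V) (map f As))"
proof -
  obtain g where g: "proper_lattice_affine g" "\<And>x. g (f x) = x" "\<And>x. f (g x) = x"
    using proper_lattice_affine_inverse[OF f] by metis
  have "map f ` {Bs. line_equiv V As Bs} = {Bs. line_equiv (f V) (map f As) Bs}"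
  proof (intro equalityI subsetI)
    fix Bs assume "Bs \<in> {Bs. line_equiv (f V) (map f As) Bs}"
    then have "line_equiv (g (f V)) (map g (map f As)) (map g Bs)"
      using line_equiv_map[OF g(1)] by blast
    then have "line_equiv V As (map g Bs)" by (simp add: g o_def)
    moreover have "Bs = map f (map g Bs)" by (simp add: g o_def)
    ultimately show "Bs \<in> map f ` {Bs. line_equiv V As Bs}" by blast
  qed (use line_equiv_map[OF f] in blast)
  then show ?thesis unfolding proper_congruent_def angle_def using f by auto
qed

subsection \<open>Continued fractions and half turns\<close>

text \<open>The pair \<open>(q, p)\<close> with \<open>p / q = [a0; a1, \<dots>, a2n]\<close>; the empty list gives the direction of the
  \<open>x\<close>-axis.\<close>

fun cf_pair :: "int list \<Rightarrow> int \<times> int" where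
  "cf_pair [] = (1, 0)"
| "cf_pair [a] = (1, a)"
| "cf_pair (a # c # S) = (let (q, p) = cf_pair S in (q + c * p, p + a * (q + c * p)))"

text \<open>With \<open>B = A + a *s w\<close> and \<open>w' = w + c *s B\<close>, the vector
  \<open>q *s B + p *s w'\<close> equals \<open>(q + c * p) *s B + p *s w\<close>: in the frame
  \<open>A\<close>, \<open>w\<close> the recursion of \<open>build\<close> is that of
  \<open>cf_pair\<close>.\<close>

lemma last_build:
  "last (build A w S) = fst (cf_pair S) *s A + snd (cf_pair S) *s w" if "odd (length S) \<or> S = []"
  using that
proof (induction A w S rule: build.induct)
  case (3 A w a c S)
  have "odd (length S)" using 3(2) by simp
  then show ?case using 3(1)
    by (simp add: lpoint_eq_iff case_prod_unfold Let_def algebra_simps)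
qed simp_all

lemma cf_elements_Cons2: "cf_elements (a # c # S) \<longleftrightarrow> a > 0 \<and> c > 0 \<and> cf_elements S"
proof -
  have "(\<exists>n. length (a # c # S) = 2 * n + 1) \<longleftrightarrow> (\<exists>n. length S = 2 * n + 1)"
    by (metis (no_types, opaque_lifting) even_Suc length_Cons odd_two_times_div_two_succ even_add even_mult_iff even_numeral odd_one)
  then show ?thesis by (auto simp: cf_elements_def)
qed

lemma cf_elements_single: "cf_elements [a] \<longleftrightarrow> a > 0"
  by (auto simp: cf_elements_def)

lemma cf_elements_odd: "cf_elements S \<Longrightarrow> odd (length S)"
  by (auto simp: cf_elements_def)

lemma cf_elements_Nil: "\<not> cf_elements []"
  by (auto simp: cf_elements_def)

lemma cf_pair_bounds:
  assumes "cf_elements S"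
  shows "1 \<le> fst (cf_pair S) \<and> fst (cf_pair S) \<le> snd (cf_pair S)"
  using assms
proof (induction S rule: cf_pair.induct)
  case (3 a c S)
  define q p where "q = fst (cf_pair S)" and "p = snd (cf_pair S)"
  have ih: "1 \<le> q" "q \<le> p" "a \<ge> 1" "c \<ge> 1" using 3 by (auto simp: cf_elements_Cons2 q_def p_def)
  have "c * p \<ge> 0" using ih by simp
  then have 1: "1 \<le> q + c * p" using ih by linarith
  then have "q + c * p \<le> a * (q + c * p)" using ih(3) by (simp add: mult_le_cancel_right1)
  then have "q + c * p \<le> p + a * (q + c * p)" using ih by linarith
  with 1 show ?case by (simp add: case_prod_unfold Let_def q_def p_def)
qed (auto simp: cf_elements_single cf_elements_Nil)

text \<open>Euclidean division recovers the elements two at a time. Between lists of odd length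
  there is no ambiguity of the form \<open>a\<close> against \<open>a - 1, 1\<close>.\<close>

lemma cf_pair_inject:
  assumes "cf_elements S" "cf_elements T" "cf_pair S = cf_pair T"
  shows "S = T"
  using assms
proof (induction S arbitrary: T rule: cf_pair.induct)
  \<comment> \<open>The denominator separates one-element lists from longer ones.\<close>
  have long: "fst (cf_pair (a # c # S)) > 1" if "cf_elements (a # c # S)" for a c S
  proof -
    have "c * snd (cf_pair S) \<ge> 1" "fst (cf_pair S) \<ge> 1"
      using cf_pair_bounds[of S] that by (auto simp: cf_elements_Cons2 int_one_le_iff_zero_less)
    then show ?thesis by (simp add: case_prod_unfold Let_def)
  qed
  {
    case 1 then show ?case by (simp add: cf_elements_Nil)
  next
    case (2 a)
    show ?case
    proof (cases T rule: cf_pair.cases)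
      case (3 b d T')
      then show ?thesis using 2 long[of b d T'] by (metis cf_pair.simps(2) fst_conv less_irrefl)
    qed (use 2 in \<open>auto simp: cf_elements_Nil\<close>)
  next
    case (3 a c S)
    show ?case
    proof (cases T rule: cf_pair.cases)
      case 1 then show ?thesis using 3 by (simp add: cf_elements_Nil)
    next
      case (2 b) then show ?thesis using 3 long[of a c S] by (metis cf_pair.simps(2) fst_conv less_irrefl)
    next
      case T: (3 b d T')
      have c: "c > 0" "d > 0" "cf_elements S" "cf_elements T'"
        using 3(2,3) T by (auto simp: cf_elements_Cons2)
      obtain q p where qp: "cf_pair S = (q, p)" by force
      obtain q' p' where qp': "cf_pair T' = (q', p')" by force
      have bd: "1 \<le> q" "q \<le> p" "1 \<le> q'" "q' \<le> p'"
        using cf_pair_bounds[OF c(3)] cf_pair_bounds[OF c(4)] by (simp_all add: qp qp')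
      have e: "q + c * p = q' + d * p'" "p + a * (q + c * p) = p' + b * (q + c * p)"
        using 3(4) T by (auto simp: qp qp')
      have "p \<le> c * p" "p' \<le> d * p'" using c bd by (simp_all add: mult_le_cancel_right1)
      then have lt: "p < q + c * p" "p' < q + c * p" using bd e by linarith+
      have "(p + a * (q + c * p)) div (q + c * p) = a" "(p' + b * (q + c * p)) div (q + c * p) = b"
        using lt bd by (simp_all add: div_pos_pos_trivial)
      then have ab: "a = b" using e(2) by simp
      then have pp: "p = p'" using e(2) by simp
      \<comment> \<open>The remainder \<open>q\<close> ranges over \<open>1..p\<close> and not
        \<open>0..p - 1\<close>, so 1 is subtracted before dividing.\<close>
      have "((q - 1) + c * p) div p = c" "((q' - 1) + d * p) div p = d"
        using bd pp by (simp_all add: div_pos_pos_trivial)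
      moreover have "(q - 1) + c * p = (q' - 1) + d * p" using e(1) pp by simp
      ultimately have cd: "c = d" by simp
      then have "q = q'" using e(1) pp by simp
      then have "S = T'" using 3(1)[OF c(3,4)] qp qp' pp by simp
      then show ?thesis using T ab cd by simp
    qed
  }
qed

lemma cf_pair_exists:
  assumes "1 \<le> q" "q \<le> p" "coprime q p"
  shows "\<exists>S. cf_elements S \<and> cf_pair S = (q, p)"
  using assms
proof (induction "nat q" arbitrary: q p rule: less_induct)
  case less
  show ?case
  proof (cases "q = 1")
    case True
    then have "cf_elements [p] \<and> cf_pair [p] = (q, p)" using less by (simp add: cf_elements_single)
    then show ?thesis by blast
  next
    case False
    define a r where "a = p div q" and "r = p mod q"
    have p: "p = r + a * q" by (simp add: a_def r_def)
    have "r \<noteq> 0"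
    proof
      assume "r = 0"
      then have "q dvd p" by (simp add: r_def dvd_eq_mod_eq_0)
      then have "is_unit q" using less(4) by (metis coprime_absorb_left)
      then show False using False less(2) by simp
    qed
    moreover have "0 \<le> r" "r < q" using less(2) by (simp_all add: r_def)
    ultimately have r: "0 < r" "r < q" by simp_all
    have a: "a > 0" using less(2,3) by (simp add: a_def pos_imp_zdiv_pos_iff)
    \<comment> \<open>Division with remainder \<open>q'\<close> in \<open>1..r\<close>, as the
      bounds for the tail require; the remainder 0 is replaced by \<open>r\<close> with a smaller
      quotient.\<close>
    define c q' where "c = (q - 1) div r" and "q' = (q - 1) mod r + 1"
    have q: "q = q' + c * r" by (simp add: c_def q'_def)
    have "0 \<le> (q - 1) mod r" "(q - 1) mod r < r" using r by simp_all
    then have q': "1 \<le> q'" "q' \<le> r" by (simp_all add: q'_def)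
    have c: "c > 0" using r by (simp add: c_def pos_imp_zdiv_pos_iff)
    have "coprime q' r"
    proof (rule coprimeI)
      fix x assume "x dvd q'" "x dvd r"
      then have "x dvd q" unfolding q by simp
      moreover then have "x dvd p" using \<open>x dvd r\<close> unfolding p by simp
      ultimately show "is_unit x" using less(4) by (meson coprime_common_divisor)
    qed
    moreover have "nat q' < nat q" using q' r by linarith
    ultimately obtain S where S: "cf_elements S" "cf_pair S = (q', r)"
      using less(1)[of q' r] q' by blast
    then have "cf_elements (a # c # S) \<and> cf_pair (a # c # S) = (q, p)"
      using a c by (simp add: cf_elements_Cons2 flip: p q)
    then show ?thesis by blast
  qed
qed

text \<open>A horizontal shear changes the first coordinate by multiples of the second, so it can be
  moved to the one residue in \<open>1..p\<close> for which a positive expansion exists. On the axis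
  a primitive vector is already \<open>(1, 0)\<close> up to sign.\<close>

lemma primitive_reduction:
  assumes "primitive P"
  obtains m \<sigma> S where "\<bar>\<sigma>\<bar> = 1" "S = [] \<or> cf_elements S"
    "vector [P$1 + m * P$2, P$2] = \<sigma> *s (vector [fst (cf_pair S), snd (cf_pair S)] :: lpoint)"
proof (cases "P$2 = 0")
  case True
  then have "\<bar>P$1\<bar> = 1" using assms by (simp add: primitive_def)
  then show thesis using True by (intro that[of "P$1" "[]" 0]) (auto simp: lpoint_eq_iff)
next
  case False
  define \<sigma> p where "\<sigma> = sgn (P$2)" and "p = \<bar>P$2\<bar>"
  define x where "x = \<sigma> * P$1"
  define q where "q = (x - 1) mod p + 1"
  define m where "m = - ((x - 1) div p)"
  have s: "\<bar>\<sigma>\<bar> = 1" "\<sigma> * \<sigma> = 1" "P$2 = \<sigma> * p" "\<sigma> * P$2 = p" "p > 0"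
    using False by (auto simp: \<sigma>_def p_def sgn_if)
  have P1: "P$1 = \<sigma> * x" using s by (simp add: x_def mult.assoc[symmetric])
  have q: "q = x + m * p"
    unfolding q_def m_def using div_mult_mod_eq[of "x - 1" p] by (simp add: algebra_simps)
  have "0 \<le> (x - 1) mod p" "(x - 1) mod p < p" using s(5) by simp_all
  then have q1: "1 \<le> q" "q \<le> p" by (simp_all add: q_def)
  have "coprime q p"
  proof (rule coprimeI)
    fix y assume "y dvd q" "y dvd p"
    then have "y dvd q - m * p" by simp
    then have "y dvd x" by (simp add: q)
    then have "y dvd P$1" "y dvd P$2" using \<open>y dvd p\<close> P1 s(3) by simp_all
    then show "is_unit y" using assms unfolding primitive_def by (meson coprime_common_divisor)
  qed
  then obtain S where "cf_elements S" "cf_pair S = (q, p)" using cf_pair_exists q1 by blast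
  then show thesis using s P1
    by (intro that[of \<sigma> S m]) (auto simp: lpoint_eq_iff q algebra_simps)
qed

section \<open>Turns of lines with positive or half-turn sequences\<close>

lemma build_snoc: "odd (length S) \<Longrightarrow> build A w (S @ [c]) = build A w S"
  by (induction A w S rule: build.induct) auto

lemma unit_broken_line_build:
  assumes "cross A w = 1" "0 \<notin> set S"
  shows "unit_broken_line 0 (build A w S)"
proof (cases "odd (length S)")
  case True
  then show ?thesis using build_line[OF assms(1) True assms(2)] unfolding unit_broken_line_def by blast
next
  case False
  show ?thesis
  proof (cases S rule: rev_cases)
    case Nil
    have "primitive (- A)" using primitive_if_abs_cross[of "- A" w] assms(1) by (simp add: cross_simps)
    then show ?thesis using Nil by (simp add: unit_broken_line_def)
  next
    case (snoc T c)
    then have "odd (length T)" using False by simp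
    then show ?thesis using build_line[OF assms(1), of T] assms(2) snoc
      unfolding unit_broken_line_def by (simp add: build_snoc)
  qed
qed

lemma build_positive_half_plane:
  assumes "\<forall>a\<in>set S. a > 0" "s * A$2 \<ge> 0" "s * w$2 \<ge> 0" "P \<in> set (build A w S)"
  shows "s * P$2 \<ge> 0"
  using assms
proof (induction A w S rule: build.induct)
  case (2 A w a)
  then show ?case by (auto simp: distrib_left mult.left_commute)
next
  case (3 A w a c S)
  have "a > 0" "c > 0" using 3(2) by auto
  then have 1: "s * (A + a *s w)$2 \<ge> 0" using 3 by (simp add: distrib_left mult.left_commute)
  have "0 \<le> s * w$2 + c * (s * (A + a *s w)$2)"
    using 3(4) mult_nonneg_nonneg[OF less_imp_le[OF \<open>c > 0\<close>] 1] by linarith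
  also have "\<dots> = s * (w + c *s (A + a *s w))$2"
    by (simp add: algebra_simps)
  finally have "s * (w + c *s (A + a *s w))$2 \<ge> 0" .
  then show ?case using 3 1 by auto
qed simp

lemma Arg_1 [simp]: "Arg 1 = 0"
  by (simp add: Arg_eq_Im_Ln)

lemma Arg_minus_1 [simp]: "Arg (- 1) = pi"
  by (simp add: Arg_eq_Im_Ln)

text \<open>All frames of determinant one whose first vector is on the \<open>x\<close>-axis:
  \<open>\<sigma>\<close> records the parity of the half turns made so far, \<open>m\<close> the
  shear that fixing the first vertex leaves free.\<close>

definition axis_frame :: "int \<Rightarrow> int \<Rightarrow> lpoint \<Rightarrow> lpoint \<Rightarrow> bool" where
  "axis_frame \<sigma> m A w \<longleftrightarrow> \<bar>\<sigma>\<bar> = 1 \<and> A = \<sigma> *s vector [1, 0] \<and> w = \<sigma> *s vector [m, 1]"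

lemma axis_frame_cross: "axis_frame \<sigma> m A w \<Longrightarrow> cross A w = 1"
  by (auto simp: axis_frame_def cross_def abs_if split: if_splits)

text \<open>Positive entries only add nonnegative combinations, so the line stays on the side of the
  axis given by \<open>\<sigma>\<close> and its turn is a single argument.\<close>

lemma build_cf_turn:
  assumes "axis_frame \<sigma> m A w" "S = [] \<or> cf_elements S"
  defines "R \<equiv> vector [fst (cf_pair S) + m * snd (cf_pair S), snd (cf_pair S)]"
  shows "last (build A w S) = \<sigma> *s R" "turn (build A w S) = Arg (cpoint R)"
proof -
  have A: "\<bar>\<sigma>\<bar> = 1" "A = \<sigma> *s vector [1, 0]" "w = \<sigma> *s vector [m, 1]"
    using assms(1) by (simp_all add: axis_frame_def)
  have ss: "\<sigma> * \<sigma> = 1" using A(1) by (metis abs_mult_self_eq mult_1)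
  have pos: "\<forall>a\<in>set S. a > 0" using assms(2) by (auto simp: cf_elements_def)
  show l: "last (build A w S) = \<sigma> *s R"
    using assms(2) cf_elements_odd by (subst last_build) (auto simp: A R_def lpoint_eq_iff algebra_simps)
  have "unit_broken_line 0 (build A w S)"
    using pos by (intro unit_broken_line_build axis_frame_cross[OF assms(1)]) auto
  then have "steps_apart (build A w S)" using unit_broken_line_props by blast
  moreover have "\<sigma> * P$2 \<ge> 0" if "P \<in> set (build A w S)" for P
    by (rule build_positive_half_plane[OF pos _ _ that]) (simp_all add: A(2,3) ss)
  ultimately have "turn (build A w S) =
      Arg (cpoint (\<sigma> *s last (build A w S))) - Arg (cpoint (\<sigma> *s A))"
    using turn_half_plane[of "build A w S" \<sigma>] A(1) by simp
  moreover have "\<sigma> *s A = vector [1, 0]" by (simp add: A vector_smult_assoc ss)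
  then have "cpoint (\<sigma> *s A) = 1" by (simp add: complex_eq_iff)
  ultimately show "turn (build A w S) = Arg (cpoint R)"
    unfolding l by (simp add: vector_smult_assoc ss)
qed

text \<open>The origin of the blocks: after one segment of signed length \<open>\<epsilon>\<close>,
  the sine \<open>- 2 * \<epsilon>\<close> makes the next such segment end at \<open>- A\<close>,
  and the second sine \<open>- 2 * \<epsilon>\<close> turns the direction into
  \<open>- w\<close>.\<close>

lemma build_half_turn:
  "build A w (\<epsilon> # (- 2 * \<epsilon>) # \<epsilon> # (- 2 * \<epsilon>) # S) = A # (A + \<epsilon> *s w) # build (- A) (- w) S" if "\<bar>\<epsilon>\<bar> = 1"
proof -
  have "\<epsilon> = 1 \<or> \<epsilon> = -1" using that by linarith
  then have "A + \<epsilon> *s w + \<epsilon> *s (w + (- 2 * \<epsilon>) *s (A + \<epsilon> *s w)) = - A"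
    "w + (- 2 * \<epsilon>) *s (A + \<epsilon> *s w) + (- 2 * \<epsilon>) *s (- A) = - w"
    by (auto simp: lpoint_eq_iff)
  then show ?thesis unfolding build.simps by (simp only:)
qed

lemma turn_half_turn:
  assumes "axis_frame \<sigma> m A w" "\<bar>\<epsilon>\<bar> = 1"
  shows "turn (A # (A + \<epsilon> *s w) # build (- A) (- w) S) = of_int \<epsilon> * pi + turn (build (- A) (- w) S)"
proof -
  have A: "\<bar>\<sigma>\<bar> = 1" "A = \<sigma> *s vector [1, 0]" "w = \<sigma> *s vector [m, 1]"
    using assms(1) by (simp_all add: axis_frame_def)
  have c: "cross A w = 1" by (rule axis_frame_cross[OF assms(1)])
  have ss: "\<sigma> * \<sigma> = 1" "\<epsilon> * \<epsilon> = 1" using A(1) assms(2) by (metis abs_mult_self_eq mult_1)+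
  have e: "\<epsilon> = 1 \<or> \<epsilon> = -1" using assms(2) by linarith
  let ?L = "[A, A + \<epsilon> *s w, - A]"
  have "A \<noteq> 0" using c by (auto simp: cross_simps)
  \<comment> \<open>The middle vertex has second coordinate \<open>\<epsilon> * \<sigma>\<close>, so
    \<open>\<sigma> * \<epsilon>\<close> is the sign of the half plane containing the
    detour.\<close>
  then have "steps_apart ?L"
    using c e by (auto simp: cross_simps cross_swap[of w])
  moreover have "\<bar>\<sigma> * \<epsilon>\<bar> = 1" using A(1) assms(2) by (simp add: abs_mult)
  moreover have "(\<sigma> * \<epsilon>) * P$2 \<ge> 0" if "P \<in> set ?L" for P
  proof -
    have "(\<sigma> * \<epsilon>) * (\<epsilon> * \<sigma>) = 1" using ss by (simp add: mult.assoc mult.left_commute)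
    then show ?thesis using that by (auto simp: A)
  qed
  ultimately have "turn ?L = Arg (cpoint ((\<sigma> * \<epsilon>) *s (- A))) - Arg (cpoint ((\<sigma> * \<epsilon>) *s A))"
    using turn_half_plane[of ?L "\<sigma> * \<epsilon>"] by simp
  moreover have "(\<sigma> * \<epsilon>) *s A = \<epsilon> *s vector [1, 0]"
    using ss by (simp add: A vector_smult_assoc mult.commute mult.left_commute)
  moreover have "cpoint (vector [1, 0]) = 1" by (simp add: complex_eq_iff)
  ultimately have "turn ?L = of_int \<epsilon> * pi"
    using e by (auto simp: vector_sneg_minus1[symmetric])
  moreover have "turn (A # (A + \<epsilon> *s w) # build (- A) (- w) S) = turn ?L + turn (build (- A) (- w) S)"
    by (subst (1 2) build_hd) simp
  ultimately show ?thesis by simp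
qed

definition half_turns :: "int \<Rightarrow> int list" where
  "half_turns k = copies (if k \<ge> 0 then [1, -2, 1, -2] else [-1, 2, -1, 2]) (nat \<bar>k\<bar>)"

lemma build_copies:
  assumes "axis_frame \<sigma> m A w" "\<bar>\<epsilon>\<bar> = 1"
  shows "turn (build A w (copies [\<epsilon>, - 2 * \<epsilon>, \<epsilon>, - 2 * \<epsilon>] n @ S)) =
           of_int \<epsilon> * of_nat n * pi + turn (build ((-1)^n *s A) ((-1)^n *s w) S) \<and>
         last (build A w (copies [\<epsilon>, - 2 * \<epsilon>, \<epsilon>, - 2 * \<epsilon>] n @ S)) =
           last (build ((-1)^n *s A) ((-1)^n *s w) S)"
  using assms(1)
proof (induction n arbitrary: \<sigma> A w)
  case 0
  then show ?case by (simp add: copies_def)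
next
  case (Suc n)
  have "axis_frame (- \<sigma>) m (- A) (- w)" using Suc(2) by (auto simp: axis_frame_def lpoint_eq_iff)
  note ih = Suc(1)[OF this]
  have e: "copies [\<epsilon>, - 2 * \<epsilon>, \<epsilon>, - 2 * \<epsilon>] (Suc n) @ S =
     \<epsilon> # (- 2 * \<epsilon>) # \<epsilon> # (- 2 * \<epsilon>) # (copies [\<epsilon>, - 2 * \<epsilon>, \<epsilon>, - 2 * \<epsilon>] n @ S)"
    by (simp add: copies_def)
  have s: "(-1)^n *s (- B) = (-1)^(Suc n) *s B" for B :: lpoint by (simp add: lpoint_eq_iff)
  show ?case
    unfolding e build_half_turn[OF assms(2)] turn_half_turn[OF Suc(2) assms(2)]
    using ih unfolding s by (simp add: algebra_simps)
qed

text \<open>The normal forms need only \<open>m = 0\<close>; general \<open>m\<close> describes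
  their images under shears, which uniqueness has to compare with them.\<close>

lemma build_half_turns:
  assumes "S = [] \<or> cf_elements S"
  defines "R m \<equiv> vector [fst (cf_pair S) + m * snd (cf_pair S), snd (cf_pair S)]"
  shows "turn (build (vector [1, 0]) (vector [m, 1]) (half_turns k @ S)) = of_int k * pi + Arg (cpoint (R m))"
    and "last (build (vector [1, 0]) (vector [m, 1]) (half_turns k @ S)) = (-1)^(nat \<bar>k\<bar>) *s R m"
proof -
  let ?A = "vector [1, 0] :: lpoint" and ?w = "vector [m, 1] :: lpoint" and ?n = "nat \<bar>k\<bar>"
  define \<epsilon> :: int where "\<epsilon> = (if k \<ge> 0 then 1 else -1)"
  have e: "\<bar>\<epsilon>\<bar> = 1" "half_turns k = copies [\<epsilon>, - 2 * \<epsilon>, \<epsilon>, - 2 * \<epsilon>] ?n"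
    "of_int \<epsilon> * of_nat ?n = (of_int k :: real)"
    by (auto simp: \<epsilon>_def half_turns_def)
  have fr: "axis_frame 1 m ?A ?w" by (simp add: axis_frame_def)
  have fr': "axis_frame ((-1)^?n) m ((-1)^?n *s ?A) ((-1)^?n *s ?w)"
    by (simp add: axis_frame_def)
  show "turn (build ?A ?w (half_turns k @ S)) = of_int k * pi + Arg (cpoint (R m))"
    "last (build ?A ?w (half_turns k @ S)) = (-1)^?n *s R m"
    using build_copies[OF fr e(1), of ?n S] build_cf_turn[OF fr' assms(1)]
    unfolding e(2,3) R_def by simp_all
qed

text \<open>A single parametrisation of the five types, so that neither existence nor uniqueness has
  to distinguish them.\<close>

fun std_form :: "int \<Rightarrow> int list \<Rightarrow> normal_form" where
  "std_form k [] = (if k = 0 then Type_I else if k > 0 then Type_II (nat k) else Type_III (nat (- k)))"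
| "std_form k (a # S) = (if k \<ge> 0 then Type_IV (nat k) (a # S) else Type_V (nat (- k)) (a # S))"

lemma std_form_valid: "S = [] \<or> cf_elements S \<Longrightarrow> valid_form (std_form k S)"
  by (cases S) auto

lemma valid_form_std:
  assumes "valid_form F"
  obtains k S where "S = [] \<or> cf_elements S" "F = std_form k S"
proof (cases F)
  case Type_I
  then show thesis using that[of "[]" 0] by simp
next
  case (Type_II n)
  then show thesis using that[of "[]" "int n"] assms by simp
next
  case (Type_III n)
  then show thesis using that[of "[]" "- int n"] assms by simp
next
  case (Type_IV n S)
  then show thesis using that[of S "int n"] assms by (cases S) (auto simp: cf_elements_Nil)
next
  case (Type_V n S)
  then show thesis using that[of S "- int n"] assms by (cases S) (auto simp: cf_elements_Nil)
qed

lemma half_turns_nonzero: "0 \<notin> set (half_turns k)"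
  by (auto simp: half_turns_def copies_def)

lemma even_length_copies: "even (length xs) \<Longrightarrow> even (length (copies xs n))"
  by (induction n) (auto simp: copies_def)

lemma copies_Suc: "copies xs (Suc n) = copies xs n @ xs"
  by (induction n) (simp_all add: copies_def)

text \<open>Dropping the last sine of \<open>half_turns k\<close> does not change the line it builds, so the types
  I, II and III are the case of an empty continued fraction.\<close>

lemma form_angle_std:
  assumes "S = [] \<or> cf_elements S"
  shows "form_angle (std_form k S) =
         angle 0 (build (vector [1, 0]) (vector [0, 1]) (half_turns k @ S))"
proof (cases S)
  case Nil
  have *: "Phi (copies [\<epsilon>, - 2 * \<epsilon>, \<epsilon>, - 2 * \<epsilon>] (n - 1) @ [\<epsilon>, - 2 * \<epsilon>, \<epsilon>]) =
      angle 0 (build (vector [1, 0]) (vector [0, 1]) (copies [\<epsilon>, - 2 * \<epsilon>, \<epsilon>, - 2 * \<epsilon>] n))"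
    if "n \<ge> 1" "\<epsilon> \<noteq> 0" for n and \<epsilon> :: int
  proof -
    let ?T = "copies [\<epsilon>, - 2 * \<epsilon>, \<epsilon>, - 2 * \<epsilon>] (n - 1) @ [\<epsilon>, - 2 * \<epsilon>, \<epsilon>]"
    have o: "odd (length ?T)" by (simp add: even_length_copies)
    have "0 \<notin> set ?T" using that by (auto simp: copies_def)
    then have "Phi ?T = angle 0 (build (vector [1, 0]) (vector [0, 1]) ?T)"
      using o by (rule Phi_eq_build[rotated])
    also have "build (vector [1, 0]) (vector [0, 1]) ?T =
        build (vector [1, 0]) (vector [0, 1]) (?T @ [- 2 * \<epsilon>])"
      by (rule build_snoc[OF o, symmetric])
    also have "?T @ [- 2 * \<epsilon>] = copies [\<epsilon>, - 2 * \<epsilon>, \<epsilon>, - 2 * \<epsilon>] n"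
      using copies_Suc[of _ "n - 1"] that by simp
    finally show ?thesis .
  qed
  consider "k = 0" | "k > 0" | "k < 0" by linarith
  then show ?thesis
  proof cases
    case 1
    then show ?thesis using Nil by (simp add: half_turns_def copies_def)
  next
    case 2
    then show ?thesis using Nil *[of "nat k" 1] by (simp add: half_turns_def)
  next
    case 3
    then show ?thesis using Nil *[of "nat (- k)" "-1"] by (simp add: half_turns_def)
  qed
next
  case (Cons a T)
  then have S: "cf_elements S" using assms by auto
  have "odd (length (half_turns k @ S))"
    using cf_elements_odd[OF S] by (simp add: half_turns_def even_length_copies)
  moreover have "0 \<notin> set (half_turns k @ S)"
    using S half_turns_nonzero by (auto simp: cf_elements_def)
  ultimately have "Phi (half_turns k @ S) =
      angle 0 (build (vector [1, 0]) (vector [0, 1]) (half_turns k @ S))"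
    by (rule Phi_eq_build)
  moreover have "form_angle (std_form k S) = Phi (half_turns k @ S)"
    by (simp add: Cons half_turns_def)
  ultimately show ?thesis by simp
qed

lemma std_line_unit:
  assumes "S = [] \<or> cf_elements S"
  shows "unit_broken_line 0 (build (vector [1, 0]) (vector [m, 1]) (half_turns k @ S))"
proof (rule unit_broken_line_build)
  show "0 \<notin> set (half_turns k @ S)"
    using assms half_turns_nonzero by (auto simp: cf_elements_def)
qed (simp add: cross_def)

lemma map_build:
  assumes "\<And>x y. f (x + y) = f x + f y" "\<And>m x. f (m *s x) = m *s f x"
  shows "map f (build A w S) = build (f A) (f w) S"
  by (induction A w S rule: build.induct) (simp_all add: assms)

lemma cis_eq_sign:
  assumes "cis x = of_int \<sigma>" "\<bar>\<sigma>\<bar> = 1"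
  obtains k :: int where "x = of_int k * pi" "(-1)^(nat \<bar>k\<bar>) = \<sigma>"
proof -
  have sc: "sin x = 0" "cos x = of_int \<sigma>" using assms(1) by (simp_all add: complex_eq_iff)
  obtain k :: int where k: "x = of_int k * pi" using sc(1) by (auto simp: sin_zero_iff_int2)
  have "even (nat \<bar>k\<bar>) \<longleftrightarrow> even k" by (simp add: even_nat_iff)
  then have "(-1)^(nat \<bar>k\<bar>) = \<sigma>"
    using sc(2) cos_npi_int[of k] unfolding k by (auto simp: mult.commute split: if_splits)
  then show thesis using k that by blast
qed

subsection \<open>Classification\<close>

lemma angle_eq_if_line_equiv: "line_equiv 0 As Bs \<Longrightarrow> angle 0 As = angle 0 Bs"
  by (auto simp: angle_def line_equiv_iff_turn)

lemma congruent_to_std_form: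
  assumes unit: "unit_broken_line V As"
  obtains k S where "S = [] \<or> cf_elements S" "proper_congruent (angle V As) (form_angle (std_form k S))"
proof -
  \<comment> \<open>Coordinates with respect to the origin \<open>V\<close> and the basis
    \<open>P\<close>, \<open>w\<close>, by Cramer's rule.\<close>
  define f where "f P w = affine_map (w$2) (- w$1) (- P$2) (P$1) (vector [- cross V w, - cross P V])" for P w
  have f_eq: "f P w x = vector [cross (x - V) w, cross P (x - V)]" for P w x
    by (simp add: f_def lpoint_eq_iff cross_def algebra_simps)
  have f_proper: "proper_lattice_affine (f P w)" if "cross P w = 1" for P w
    unfolding proper_lattice_affine_iff f_def using that
    by (intro exI conjI) (auto simp: cross_def algebra_simps)
  have f_V: "f P w V = 0" for P w by (simp add: f_eq lpoint_eq_iff cross_simps)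
  have ne: "As \<noteq> []" using unit by (rule unit_broken_line_not_Nil)
  define P where "P = hd As - V"
  have "primitive P"
  proof -
    \<comment> \<open>For this frame the map is the translation by \<open>- V\<close>, which reduces
      the claim to a vertex at the origin.\<close>
    let ?e = "vector [1, 0] :: lpoint" and ?w = "vector [0, 1] :: lpoint"
    have "cross ?e ?w = 1" by (simp add: cross_def)
    then have "unit_broken_line 0 (map (f ?e ?w) As)"
      using unit_broken_line_map[OF f_proper unit] f_V by metis
    then have "primitive (f ?e ?w (hd As))" using unit_broken_line_props ne by fastforce
    then show ?thesis by (simp add: f_eq primitive_def P_def cross_def)
  qed
  then obtain w0 where w0: "cross P w0 = 1" using primitive_iff_cross by blast
  define Q where "Q = f P w0 (last As)"
  have "unit_broken_line 0 (map (f P w0) As)"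
    using unit_broken_line_map[OF f_proper[OF w0] unit] by (simp add: f_V)
  then have "primitive Q" using unit_broken_line_props ne unfolding Q_def by fastforce
  then obtain m \<sigma> S where S: "\<bar>\<sigma>\<bar> = 1" "S = [] \<or> cf_elements S"
    "vector [Q$1 + m * Q$2, Q$2] = \<sigma> *s (vector [fst (cf_pair S), snd (cf_pair S)] :: lpoint)"
    by (rule primitive_reduction)
  define R :: lpoint where "R = vector [fst (cf_pair S), snd (cf_pair S)]"
  \<comment> \<open>Subtracting \<open>m *s P\<close> from the second basis vector adds
    \<open>m\<close> times the second coordinate to the first, which is the required shear.\<close>
  define w where "w = w0 - m *s P"
  have w: "cross P w = 1" using w0 by (simp add: w_def cross_simps)
  let ?g = "f P w"
  define Bs where "Bs = map ?g As"
  have Bu: "unit_broken_line 0 Bs"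
    unfolding Bs_def using unit_broken_line_map[OF f_proper[OF w] unit] by (simp add: f_V)
  have Bh: "hd Bs = vector [1, 0]"
    using ne w by (simp add: Bs_def hd_map f_eq P_def[symmetric] cross_simps)
  have Bl: "last Bs = \<sigma> *s R"
  proof -
    have "last Bs = vector [Q$1 + m * Q$2, Q$2]"
      using ne by (simp add: Bs_def last_map f_eq Q_def w_def cross_simps cross_swap[of "last As" P] cross_swap[of V P] algebra_simps)
    then show ?thesis using S(3) by (simp add: R_def)
  qed
  have R0: "R \<noteq> 0"
  proof
    assume "R = 0"
    then have "primitive (0::lpoint)" using unit_broken_line_props[OF Bu] Bl by (metis last_in_set vector_smult_rzero)
    then show False by (simp add: primitive_def)
  qed
  have ss: "\<sigma> = 1 \<or> \<sigma> = -1" using S(1) by linarith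
  have e1: "cpoint (vector [1, 0]) = 1" by (simp add: complex_eq_iff)
  \<comment> \<open>Modulo \<open>pi\<close> the turn is the argument of \<open>R\<close>. The
    quotient is the number of half turns, and its parity must be \<open>\<sigma>\<close>, so the
    standard line ends at the same point as \<open>Bs\<close>.\<close>
  have "cis (turn Bs) = sgn (cpoint (\<sigma> *s R))"
    using cis_turn[of Bs] unit_broken_line_props[OF Bu] Bl Bh
    by (simp add: e1)
  also have "\<dots> = of_int \<sigma> * cis (Arg (cpoint R))"
    using ss R0 by (auto simp: cis_Arg vector_sneg_minus1[symmetric] sgn_minus)
  finally have "cis (turn Bs - Arg (cpoint R)) = of_int \<sigma>"
    by (simp add: cis_divide[symmetric])
  then obtain k where k: "turn Bs - Arg (cpoint R) = of_int k * pi" "(-1)^(nat \<bar>k\<bar>) = \<sigma>"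
    using S(1) by (rule cis_eq_sign)
  let ?L = "build (vector [1, 0]) (vector [0, 1]) (half_turns k @ S)"
  have "line_equiv 0 Bs ?L"
    unfolding line_equiv_iff_turn
    using Bu std_line_unit[OF S(2)] Bh Bl k build_half_turns[OF S(2), of 0 k]
    by (auto simp: R_def)
  then have "angle 0 Bs = form_angle (std_form k S)"
    using angle_eq_if_line_equiv form_angle_std[OF S(2)] by simp
  moreover have "proper_congruent (angle V As) (angle 0 Bs)"
    using proper_congruent_map[OF f_proper[OF w], of V As] by (simp add: f_V Bs_def)
  ultimately show thesis using that S(2) by metis
qed

text \<open>Both arguments are at least \<open>0\<close> and below \<open>pi\<close>, whatever
  \<open>m\<close> is, so equal turns force \<open>k = j\<close>. Equal end points then give equal
  \<open>p\<close>, and \<open>q\<close>, \<open>q'\<close> congruent modulo \<open>p\<close>; for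
  nonzero \<open>p\<close> both lie in \<open>1..p\<close>, hence \<open>m = 0\<close>.\<close>

lemma std_line_unique:
  assumes S: "S = [] \<or> cf_elements S" and T: "T = [] \<or> cf_elements T"
    and eq: "line_equiv 0 (build (vector [1, 0]) (vector [m, 1]) (half_turns k @ S))
        (build (vector [1, 0]) (vector [0, 1]) (half_turns j @ T))"
  shows "k = j \<and> S = T"
proof -
  obtain q p where qp: "cf_pair S = (q, p)" by force
  obtain q' p' where qp': "cf_pair T = (q', p')" by force
  have bS: "S = [] \<and> q = 1 \<and> p = 0 \<or> cf_elements S \<and> 1 \<le> q \<and> q \<le> p"
    using S cf_pair_bounds[of S] qp by auto
  have bT: "T = [] \<and> q' = 1 \<and> p' = 0 \<or> cf_elements T \<and> 1 \<le> q' \<and> q' \<le> p'"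
    using T cf_pair_bounds[of T] qp' by auto
  let ?R = "vector [q + m * p, p] :: lpoint" and ?R' = "vector [q', p'] :: lpoint"
  have arg: "0 \<le> Arg z \<and> Arg z < pi" if "Im z > 0 \<or> z = 1" for z
    using that Im_Ln_pos_lt_imp[of z] by (cases "z = 0") (auto simp: Arg_eq_Im_Ln)
  have "Im (cpoint ?R) > 0 \<or> cpoint ?R = 1" "Im (cpoint ?R') > 0 \<or> cpoint ?R' = 1"
    using bS bT by (auto simp: complex_eq_iff)
  then have a: "0 \<le> Arg (cpoint ?R)" "Arg (cpoint ?R) < pi" "0 \<le> Arg (cpoint ?R')" "Arg (cpoint ?R') < pi"
    using arg by blast+
  have t: "of_int k * pi + Arg (cpoint ?R) = of_int j * pi + Arg (cpoint ?R')"
    and l: "(-1)^(nat \<bar>k\<bar>) *s ?R = (-1)^(nat \<bar>j\<bar>) *s ?R'"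
    using eq build_half_turns[OF S, of m k] build_half_turns[OF T, of 0 j]
    by (auto simp: line_equiv_iff_turn qp qp')
  have "\<bar>of_int (k - j) * pi\<bar> < 1 * pi" using t a by (simp add: left_diff_distrib abs_less_iff)
  then have "\<bar>of_int (k - j)\<bar> < (1::real)" by (simp add: abs_mult)
  then have kj: "k = j" by linarith
  have "?R = ?R'" using l unfolding kj by (auto simp: lpoint_eq_iff)
  then have pp: "p = p'" and qq: "q + m * p = q'" by (auto simp: lpoint_eq_iff)
  have "S = T"
  proof (cases "p = 0")
    case True
    then show ?thesis using bS bT pp by auto
  next
    case False
    then have b: "cf_elements S" "cf_elements T" "1 \<le> q" "q \<le> p" "1 \<le> q'" "q' \<le> p"
      using bS bT pp by auto
    have "((q - 1) + m * p) div p = m" "(q' - 1) div p = 0"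
      using b by (simp_all add: div_pos_pos_trivial)
    moreover have "(q - 1) + m * p = q' - 1" using qq by simp
    ultimately have "m = 0" by simp
    then have "cf_pair S = cf_pair T" using qq pp qp qp' by simp
    then show ?thesis using cf_pair_inject b by blast
  qed
  with kj show ?thesis by simp
qed

text \<open>The two congruences combine to a transformation \<open>h\<close> between the normal
  forms. It fixes the vertex and the common first point \<open>(1, 0)\<close>, so it is a horizontal
  shear.\<close>

lemma std_form_unique:
  assumes S: "S = [] \<or> cf_elements S" and T: "T = [] \<or> cf_elements T"
    and "proper_congruent \<alpha> (form_angle (std_form k S))" "proper_congruent \<alpha> (form_angle (std_form j T))"
  shows "k = j \<and> S = T"
proof -
  define L where "L m k S = build (vector [1, 0]) (vector [m, 1]) (half_turns k @ S)" for m k S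
  obtain f where f: "proper_lattice_affine f" "f (fst \<alpha>) = 0" "map f ` snd \<alpha> = {Bs. line_equiv 0 (L 0 k S) Bs}"
    using assms(3) unfolding proper_congruent_def form_angle_std[OF S] L_def by (auto simp: angle_def)
  obtain g where g: "proper_lattice_affine g" "g (fst \<alpha>) = 0" "map g ` snd \<alpha> = {Bs. line_equiv 0 (L 0 j T) Bs}"
    using assms(4) unfolding proper_congruent_def form_angle_std[OF T] L_def by (auto simp: angle_def)
  obtain f' where f': "proper_lattice_affine f'" "\<And>x. f' (f x) = x"
    using proper_lattice_affine_inverse[OF f(1)] by metis
  define h where "h = g \<circ> f'"
  have h: "proper_lattice_affine h" "h 0 = 0" "\<And>x. h (f x) = g x"
    using proper_lattice_affine_comp[OF f'(1) g(1)] f'(2) f(2) g(2) by (auto simp: h_def) metis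
  have "line_equiv 0 (L 0 j T) (L 0 j T)"
    unfolding line_equiv_iff_turn L_def using std_line_unit[OF T] by simp
  \<comment> \<open>A line of the second class is pulled back to \<open>\<alpha>\<close> and pushed
    into the first, which connects the two standard lines through \<open>h\<close>.\<close>
  then obtain Bs where Bs: "Bs \<in> snd \<alpha>" "L 0 j T = map g Bs" using g(3) by blast
  then have "line_equiv 0 (L 0 k S) (map f Bs)" using f(3) by blast
  then have "line_equiv (h 0) (map h (L 0 k S)) (map h (map f Bs))" by (rule line_equiv_map[OF h(1)])
  then have e: "line_equiv 0 (map h (L 0 k S)) (L 0 j T)" by (simp add: h Bs o_def)
  obtain a b c d t where abcd: "a * d - b * c = 1" "h = affine_map a b c d t"
    using h(1) proper_lattice_affine_iff by blast
  have t: "t = 0" using h(2) by (simp add: abcd lpoint_eq_iff)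
  have "h (hd (L 0 k S)) = hd (L 0 j T)"
    using e by (simp add: line_equiv_iff_turn hd_map L_def)
  then have h1: "h (vector [1, 0]) = vector [1, 0]" by (simp add: L_def)
  then have "a = 1" "c = 0" by (auto simp: abcd t lpoint_eq_iff)
  with abcd(1) have "d = 1" by simp
  have hw: "h (vector [0, 1]) = vector [b, 1]"
    by (simp add: abcd t \<open>d = 1\<close> lpoint_eq_iff)
  have "map h (L 0 k S) = L b k S"
    unfolding L_def
    by (subst map_build) (auto simp: h1 hw, auto simp: abcd t lpoint_eq_iff algebra_simps)
  with e show ?thesis using std_line_unique[OF S T] by (simp add: L_def)
qed

theorem theorem3p14:
  fixes \<alpha> :: exp_angle
  assumes "expanded_lattice_angle \<alpha>"
  shows "\<exists>!F. valid_form F \<and> proper_congruent \<alpha> (form_angle F)"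
proof -
  obtain V As where "unit_broken_line V As" "\<alpha> = angle V As"
    using assms unfolding expanded_lattice_angle_def by blast
  then obtain k S where kS: "S = [] \<or> cf_elements S" "proper_congruent \<alpha> (form_angle (std_form k S))"
    using congruent_to_std_form by metis
  show ?thesis
  proof (rule ex1I[of _ "std_form k S"])
    show "valid_form (std_form k S) \<and> proper_congruent \<alpha> (form_angle (std_form k S))"
      using kS std_form_valid by blast
  next
    fix F assume F: "valid_form F \<and> proper_congruent \<alpha> (form_angle F)"
    then obtain j T where "T = [] \<or> cf_elements T" "F = std_form j T"
      using valid_form_std by metis
    then show "F = std_form k S" using std_form_unique[OF _ kS(1) _ kS(2)] F by blast
  qed
qed

end
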